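(* Let $A$ be a nontrivial uniform algebra on a compact space $K$. Let $X$ be a compact metric space such that every non-empty open subset of $X$ contains a subspace that is nowhere dense in $X$ and homeomorphic to $K$. Then there exists a sequence $\{K_n\}_{n=1}^\infty$ of pairwise disjoint, nowhere dense subspaces of $X$, each homeomorphic to $K$, such that $\bigcup_{n=1}^\infty K_n$ is dense in $X$ and $\operatorname{diam}(K_n)\to 0$. If homeomorphisms $h_n:K_n\to K$ are chosen and we set $A_n=\{f\circ h_n : f\in A\}$ for each $n$, then the collection of functions $$\tilde A=\{f\in C(X) : f|_{K_n}\in A_n \text{ for all } n\}$$ is an essential uniform algebra on $X$, and the equality $\tilde A|_{K_n}=A_n$ holds for all $n$, where $\tilde A|_{K_n}=\{f|_{K_n}: f\in\tilde A\}$. Furthermore, the following hold: (i) $\tilde A$ is natural if and only if $A$ is natural; (ii) $\tilde A$ is regular on $X$ if and only if $A$ is regular on $K$; (iii) $\tilde A$ is normal if and only if $A$ is normal; (iv) every point of $X$ is a peak point for $\tilde A$ if and only if every point of $K$ is a peak point for $A$; (v) $\tilde A$ has bounded relative units if and only if $A$ has bounded relative units; (vi) $\tilde A$ is strongly regular if and only if $A$ is strongly regular; (vii) $\tilde A$ is a Ditkin algebra if and only if $A$ is a Ditkin algebra. Moreover, $\tilde A$ has bounded relative units, with bound $1$, at every point of $X\setminus\bigcup_{n=1}^\infty K_n$, and (hence) each of these points is a peak point for $\tilde A$, at each of these points $\tilde A$ satisfies Ditkin's condition, and at each of these points $\tilde A$ is strongly regular.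
   Context: A compact space means a non-empty compact Hausdorff topological space (so compact metric spaces are non-empty). For a compact space $X$, $C(X)$ is the algebra of all continuous complex-valued functions on $X$ with the supremum norm $\|f\|_X=\sup_{x\in X}|f(x)|$. A uniform algebra on $X$ is a closed subalgebra of $C(X)$ that contains the constant functions and separates the points of $X$. Let $B$ be a uniform algebra on a compact space $X$. - $B$ is nontrivial if $B\neq C(X)$. - The essential set for $B$ is the smallest closed subset $E$ of $X$ such that $B$ contains every continuous function on $X$ that vanishes on $E$. $B$ is essential if its essential set is $X$. - $B$ is natural (on $X$) if the only non-zero multiplicative linear functionals on $B$ are the evaluations at the points of $X$. - $B$ is regular on $X$ if, for each closed subset $E\subseteq X$ and each $x\in X\setminus E$, there is $f\in B$ with $f(x)=1$ and $f(E)\subseteq\{0\}$. - $B$ is normal on $X$ if, for each pair of disjoint closed subsets $E,F$ of $X$, there is $f\in B$ with $f(E)\subseteq\{0\}$ and $f(F)\subseteq\{1\}$. $B$ is normal if it is natural and normal on $X$. - A point $x\in X$ is a peak point for $B$ if there exists $f\in B$ with $f(x)=1$ and $|f(y)|<1$ for all $y\in X\setminus\{x\}$. - For $x\in X$, let $M_x=\{f\in B: f(x)=0\}$ and $J_x=\{f\in B: f^{-1}(\{0\})\text{ is a neighborhood of }x\}$. - $B$ is strongly regular at $x$ if $J_x$ is dense in $M_x$; $B$ is strongly regular if it is strongly regular at every point of $X$. - $B$ satisfies Ditkin's condition at $x$ if, for every $f\in M_x$ and every $\varepsilon>0$, there is $g\in J_x$ with $\|gf-f\|_X<\varepsilon$;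 $B$ is a Ditkin algebra if it satisfies Ditkin's condition at every point of $X$. - For $C\ge 1$, $B$ has bounded relative units at $x$ with bound $C$ if, for every compact set $F\subseteq X\setminus\{x\}$, there is $f\in J_x$ with $\|f\|_X\le C$ and $f(F)\subseteq\{1\}$. $B$ has bounded relative units at $x$ if this holds for some $C\ge 1$; $B$ has bounded relative units if it has bounded relative units at every $x\in X$. *)

theory Defs
  imports "HOL-Analysis.Analysis"
begin

text \<open>
  A compact space is a type of class \<^class>\<open>t2_space\<close> whose universe is compact (types are
  non-empty); compactness is assumed where it is needed, not built into the definitions.
  Functions on the whole space are total functions. The restriction of a function to a
  subspace S is \<^term>\<open>restrict f S\<close>, so that two functions on S are equal iff they agree on S.
\<close>

definition cont_funs :: "('a::topological_space \<Rightarrow> complex) set" where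
  "cont_funs = {f. continuous_on UNIV f}"

text \<open>Meaningful only for bounded f, in particular for continuous f on a compact space.\<close>

definition sup_norm :: "('a \<Rightarrow> complex) \<Rightarrow> real" where
  "sup_norm f = (SUP x. cmod (f x))"

definition sup_closure :: "('a::topological_space \<Rightarrow> complex) set \<Rightarrow> ('a \<Rightarrow> complex) set" where
  "sup_closure S =
    {f \<in> cont_funs. \<forall>\<epsilon>>0. \<exists>g\<in>S. sup_norm (\<lambda>x. f x - g x) < \<epsilon>}"

definition uniform_algebra :: "('a::topological_space \<Rightarrow> complex) set \<Rightarrow> bool" where
  "uniform_algebra B \<longleftrightarrow>
     B \<subseteq> cont_funs \<and>
     (\<forall>f\<in>B. \<forall>g\<in>B. (\<lambda>x. f x + g x) \<in> B) \<and>
     (\<forall>c. \<forall>f\<in>B. (\<lambda>x. c * f x) \<in> B) \<and>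
     (\<forall>f\<in>B. \<forall>g\<in>B. (\<lambda>x. f x * g x) \<in> B) \<and>
     (\<forall>c. (\<lambda>x. c) \<in> B) \<and>
     sup_closure B \<subseteq> B \<and>
     (\<forall>x y. x \<noteq> y \<longrightarrow> (\<exists>f\<in>B. f x \<noteq> f y))"

definition nontrivial_algebra :: "('a::topological_space \<Rightarrow> complex) set \<Rightarrow> bool" where
  "nontrivial_algebra B \<longleftrightarrow> B \<noteq> cont_funs"

definition contains_vanishing_on :: "('a::topological_space \<Rightarrow> complex) set \<Rightarrow> 'a set \<Rightarrow> bool" where
  "contains_vanishing_on B E \<longleftrightarrow> (\<forall>f\<in>cont_funs. (\<forall>x\<in>E. f x = 0) \<longrightarrow> f \<in> B)"

definition is_essential_set :: "('a::topological_space \<Rightarrow> complex) set \<Rightarrow> 'a set \<Rightarrow> bool" where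
  "is_essential_set B E \<longleftrightarrow>
     closed E \<and> contains_vanishing_on B E \<and>
     (\<forall>E'. closed E' \<and> contains_vanishing_on B E' \<longrightarrow> E \<subseteq> E')"

definition essential_algebra :: "('a::topological_space \<Rightarrow> complex) set \<Rightarrow> bool" where
  "essential_algebra B \<longleftrightarrow> is_essential_set B UNIV"

text \<open>The values of \<phi> outside B are irrelevant.\<close>

definition mult_lin_functional :: "('a \<Rightarrow> complex) set \<Rightarrow> (('a \<Rightarrow> complex) \<Rightarrow> complex) \<Rightarrow> bool" where
  "mult_lin_functional B \<phi> \<longleftrightarrow>
     (\<forall>f\<in>B. \<forall>g\<in>B. \<phi> (\<lambda>x. f x + g x) = \<phi> f + \<phi> g) \<and>
     (\<forall>c. \<forall>f\<in>B. \<phi> (\<lambda>x. c * f x) = c * \<phi> f) \<and>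
     (\<forall>f\<in>B. \<forall>g\<in>B. \<phi> (\<lambda>x. f x * g x) = \<phi> f * \<phi> g)"

definition natural_algebra :: "('a \<Rightarrow> complex) set \<Rightarrow> bool" where
  "natural_algebra B \<longleftrightarrow>
     (\<forall>\<phi>. mult_lin_functional B \<phi> \<and> (\<exists>f\<in>B. \<phi> f \<noteq> 0) \<longrightarrow> (\<exists>x. \<forall>f\<in>B. \<phi> f = f x))"

definition regular_on_space :: "('a::topological_space \<Rightarrow> complex) set \<Rightarrow> bool" where
  "regular_on_space B \<longleftrightarrow>
     (\<forall>E x. closed E \<and> x \<notin> E \<longrightarrow> (\<exists>f\<in>B. f x = 1 \<and> f ` E \<subseteq> {0}))"

definition normal_on_space :: "('a::topological_space \<Rightarrow> complex) set \<Rightarrow> bool" where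
  "normal_on_space B \<longleftrightarrow>
     (\<forall>E F. closed E \<and> closed F \<and> E \<inter> F = {} \<longrightarrow> (\<exists>f\<in>B. f ` E \<subseteq> {0} \<and> f ` F \<subseteq> {1}))"

definition normal_algebra :: "('a::topological_space \<Rightarrow> complex) set \<Rightarrow> bool" where
  "normal_algebra B \<longleftrightarrow> natural_algebra B \<and> normal_on_space B"

definition peak_point :: "('a \<Rightarrow> complex) set \<Rightarrow> 'a \<Rightarrow> bool" where
  "peak_point B x \<longleftrightarrow> (\<exists>f\<in>B. f x = 1 \<and> (\<forall>y. y \<noteq> x \<longrightarrow> cmod (f y) < 1))"

definition M_ideal :: "('a \<Rightarrow> complex) set \<Rightarrow> 'a \<Rightarrow> ('a \<Rightarrow> complex) set" where
  "M_ideal B x = {f \<in> B. f x = 0}"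

definition J_ideal :: "('a::topological_space \<Rightarrow> complex) set \<Rightarrow> 'a \<Rightarrow> ('a \<Rightarrow> complex) set" where
  "J_ideal B x = {f \<in> B. x \<in> interior (f -` {0})}"

definition strongly_regular_at :: "('a::topological_space \<Rightarrow> complex) set \<Rightarrow> 'a \<Rightarrow> bool" where
  "strongly_regular_at B x \<longleftrightarrow> M_ideal B x \<subseteq> sup_closure (J_ideal B x)"

definition strongly_regular :: "('a::topological_space \<Rightarrow> complex) set \<Rightarrow> bool" where
  "strongly_regular B \<longleftrightarrow> (\<forall>x. strongly_regular_at B x)"

definition ditkin_at :: "('a::topological_space \<Rightarrow> complex) set \<Rightarrow> 'a \<Rightarrow> bool" where
  "ditkin_at B x \<longleftrightarrow>
     (\<forall>f \<in> M_ideal B x. \<forall>\<epsilon>>0. \<exists>g \<in> J_ideal B x. sup_norm (\<lambda>y. g y * f y - f y) < \<epsilon>)"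

definition ditkin_algebra :: "('a::topological_space \<Rightarrow> complex) set \<Rightarrow> bool" where
  "ditkin_algebra B \<longleftrightarrow> (\<forall>x. ditkin_at B x)"

definition bounded_rel_units_at_with ::
    "('a::topological_space \<Rightarrow> complex) set \<Rightarrow> 'a \<Rightarrow> real \<Rightarrow> bool" where
  "bounded_rel_units_at_with B x C \<longleftrightarrow>
     (\<forall>F. compact F \<and> F \<subseteq> UNIV - {x} \<longrightarrow>
        (\<exists>f \<in> J_ideal B x. sup_norm f \<le> C \<and> f ` F \<subseteq> {1}))"

definition bounded_rel_units_at :: "('a::topological_space \<Rightarrow> complex) set \<Rightarrow> 'a \<Rightarrow> bool" where
  "bounded_rel_units_at B x \<longleftrightarrow> (\<exists>C\<ge>1. bounded_rel_units_at_with B x C)"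

definition bounded_rel_units :: "('a::topological_space \<Rightarrow> complex) set \<Rightarrow> bool" where
  "bounded_rel_units B \<longleftrightarrow> (\<forall>x. bounded_rel_units_at B x)"

definition nowhere_dense :: "'a::topological_space set \<Rightarrow> bool" where
  "nowhere_dense S \<longleftrightarrow> interior (closure S) = {}"

definition restrict_algebra :: "('a \<Rightarrow> complex) set \<Rightarrow> 'a set \<Rightarrow> ('a \<Rightarrow> complex) set" where
  "restrict_algebra B S = (\<lambda>f. restrict f S) ` B"

text \<open>The algebra \<open>{f \<circ> h : f \<in> A}\<close> of functions on S, for a map h from S to the space of A.\<close>

definition transport_algebra ::
    "('k \<Rightarrow> complex) set \<Rightarrow> 'x set \<Rightarrow> ('x \<Rightarrow> 'k) \<Rightarrow> ('x \<Rightarrow> complex) set" where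
  "transport_algebra A S h = (\<lambda>f. restrict (f \<circ> h) S) ` A"

definition tilde_algebra ::
    "('k \<Rightarrow> complex) set \<Rightarrow> (nat \<Rightarrow> 'x::topological_space set) \<Rightarrow> (nat \<Rightarrow> 'x \<Rightarrow> 'k) \<Rightarrow> ('x \<Rightarrow> complex) set" where
  "tilde_algebra A Kn h =
     {f \<in> cont_funs. \<forall>n. restrict f (Kn n) \<in> transport_algebra A (Kn n) (h n)}"

end

theory Submission
  imports Defs
begin

text \<open>
  Collapsing all the pieces \<open>K n\<close> except finitely many gives a compact Hausdorff quotient of \<open>X\<close>,
  because the diameters tend to zero: the saturation of a closed set is closed. Tietze's theorem
  in that quotient extends any function given on a remaining piece, or on a closed set, to a
  function on \<open>X\<close> that is constant on each collapsed piece. Such functions lie in the algebra as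
  soon as their restrictions to the remaining pieces do, since \<open>A\<close> contains
  the constants. Restriction to a piece transfers each property from the large algebra to \<open>A\<close>;
  for the converse one extends a solution on a piece and multiplies by cutoff functions coming
  from the quotient. For naturality, a character restricted to the functions constant on all
  pieces is evaluation at a point of the full quotient, and by continuity it then depends only
  on the values on the corresponding point or piece.
\<close>

section \<open>Extension of functions that are constant on a null family of pieces\<close>

text \<open>Membership in the algebra is tested on every piece at once, so multiplying by an
  arbitrary cutoff on \<open>X\<close> is not allowed: a factor is harmless where it is constant on
  a piece or leaves the values on the piece unchanged. This is why the topological tools are stated
  relative to an index set of collapsed pieces. That set varies: all pieces for points outside them,
  all but one for points on a piece, all but finitely many for normality, none for essentialness. A
  second obstacle is that an element of \<open>J_ideal A k\<close>, once extended, vanishes near the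
  point only inside its piece; \<open>localise\<close> enlarges the zero set to a neighborhood in
  \<open>X\<close>. Characters are purely algebraic here, so the continuity used for naturality is
  derived from uniform closedness through the geometric series.\<close>

lemma constant_on_compose: "f constant_on A \<Longrightarrow> (\<lambda>x. h (f x)) constant_on A"
  by (auto simp: constant_on_def)

lemma constant_on_compose2:
  "f constant_on A \<Longrightarrow> g constant_on A \<Longrightarrow> (\<lambda>x. h (f x) (g x)) constant_on A"
  by (fastforce simp: constant_on_def)

lemma closed_disjoint_ball:
  fixes C :: "'a::metric_space set"
  assumes "closed C" "x \<notin> C"
  shows "\<exists>r>0. ball x r \<inter> C = {}"
  using assms open_contains_ball[of "- C"] by (auto simp: open_Compl disjoint_eq_subset_Compl)

locale null_family =
  fixes K :: "nat \<Rightarrow> 'x::metric_space set"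
  assumes compact_space: "compact (UNIV :: 'x set)"
    and compact_piece: "compact (K n)"
    and disjoint_pieces: "disjoint_family K"
    and diameter_pieces: "(\<lambda>n. diameter (K n)) \<longlonglongrightarrow> 0"
begin

section \<open>Functions constant on the collapsed pieces, and closed saturations\<close>

lemma closed_piece: "closed (K n)"
  by (simp add: compact_piece compact_imp_closed)

lemma piece_unique: "x \<in> K m \<Longrightarrow> x \<in> K n \<Longrightarrow> m = n"
  using disjoint_pieces by (auto simp: disjoint_family_on_def)

lemma compact_closed: "closed (S :: 'x set) \<Longrightarrow> compact S"
  by (metis compact_space closed_Int_compact inf_top.right_neutral)

text \<open>Encodes continuous functions on the quotient of \<open>X\<close> by the pieces indexed
  by \<open>I\<close> without introducing a quotient type; the pieces outside \<open>I\<close> stay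
  intact.\<close>

definition collapsing :: "nat set \<Rightarrow> ('x \<Rightarrow> 'b::topological_space) \<Rightarrow> bool" where
  "collapsing I F \<longleftrightarrow> continuous_on UNIV F \<and> (\<forall>m\<in>I. F constant_on K m)"

definition cutoff :: "nat set \<Rightarrow> ('x \<Rightarrow> real) \<Rightarrow> bool" where
  "cutoff I d \<longleftrightarrow> collapsing I d \<and> (\<forall>x. 0 \<le> d x \<and> d x \<le> 1)"

lemma collapsing_continuous: "collapsing I F \<Longrightarrow> continuous_on UNIV F"
  by (simp add: collapsing_def)

lemma collapsing_compose:
  assumes "collapsing I F" "continuous_on UNIV (\<lambda>x. u (F x))"
  shows "collapsing I (\<lambda>x. u (F x))"
  using assms by (simp add: collapsing_def constant_on_compose)

lemma collapsing_combine:
  assumes "collapsing I F" "collapsing I G" "continuous_on UNIV (\<lambda>x. u (F x) (G x))"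
  shows "collapsing I (\<lambda>x. u (F x) (G x))"
  using assms by (simp add: collapsing_def constant_on_compose2)

lemma collapsing_complex_of_real:
  "collapsing I d \<Longrightarrow> collapsing I (\<lambda>x. complex_of_real (d x))"
  by (rule collapsing_compose) (auto intro!: continuous_intros collapsing_continuous)

lemma cutoff_collapsing: "cutoff I d \<Longrightarrow> collapsing I d"
  by (simp add: cutoff_def)

text \<open>The preimage in \<open>X\<close> of the image of \<open>C\<close> in the
  quotient.\<close>

definition saturate :: "nat set \<Rightarrow> 'x set \<Rightarrow> 'x set" where
  "saturate I C = C \<union> (\<Union>m\<in>{m\<in>I. K m \<inter> C \<noteq> {}}. K m)"

lemma finite_large_pieces:
  assumes "\<epsilon> > 0" shows "finite {n. diameter (K n) \<ge> \<epsilon>}"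
proof -
  have "eventually (\<lambda>n. diameter (K n) < \<epsilon>) sequentially"
    using diameter_pieces assms by (simp add: order_tendsto_iff)
  then obtain N where "\<And>n. n \<ge> N \<Longrightarrow> diameter (K n) < \<epsilon>"
    by (auto simp: eventually_sequentially)
  then have "{n. diameter (K n) \<ge> \<epsilon>} \<subseteq> {..<N}"
    by (metis (mono_tags, lifting) lessThan_iff mem_Collect_eq not_less subsetI)
  then show ?thesis by (rule finite_subset) simp
qed

text \<open>A piece that meets both \<open>C\<close> and a small ball around a point off
  \<open>C\<close> must be large, and only finitely many pieces are large. Their union with
  \<open>C\<close> is closed, so a limit point of the saturation cannot escape it.\<close>

lemma closed_saturate:
  assumes "closed C" shows "closed (saturate I C)"
  unfolding closed_limpt
proof (intro allI impI)
  fix x assume x: "x islimpt saturate I C"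
  show "x \<in> saturate I C"
  proof (rule ccontr)
    assume nx: "x \<notin> saturate I C"
    then have "x \<notin> C" by (simp add: saturate_def)
    then obtain r where r: "r > 0" "ball x r \<inter> C = {}"
      using closed_disjoint_ball[OF assms] by blast
    \<comment> \<open>The threshold \<open>r/2\<close> fits the triangle inequality: a point within
      \<open>r/2\<close> of \<open>x\<close>, on a piece of diameter below \<open>r/2\<close> that
      meets \<open>C\<close>, would put a point of \<open>C\<close> into
      \<open>ball x r\<close>.\<close>
    define N where "N = {m\<in>I. K m \<inter> C \<noteq> {} \<and> diameter (K m) \<ge> r/2}"
    have "finite N"
      using finite_large_pieces[of "r/2"] r(1) by (auto simp: N_def intro: rev_finite_subset)
    then have cN: "closed (C \<union> (\<Union>m\<in>N. K m))"
      using assms closed_piece by blast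
    have "x \<notin> C \<union> (\<Union>m\<in>N. K m)"
      using nx by (auto simp: saturate_def N_def)
    then obtain s where s: "s > 0" "ball x s \<inter> (C \<union> (\<Union>m\<in>N. K m)) = {}"
      using closed_disjoint_ball[OF cN] by blast
    obtain y where y: "y \<in> saturate I C" "y \<in> ball x (min s (r/2))"
      using x r(1) s(1) unfolding islimpt_def
      by (metis centre_in_ball half_gt_zero min_less_iff_conj open_ball)
    have "y \<notin> C \<union> (\<Union>m\<in>N. K m)"
      using y(2) s(2) by auto
    then obtain m z where m: "m \<in> I" "y \<in> K m" "z \<in> K m" "z \<in> C" "m \<notin> N"
      using y(1) unfolding saturate_def by blast
    then have "dist y z < r/2"
      using diameter_bounded_bound[OF compact_imp_bounded[OF compact_piece], of y m z]
      by (auto simp: N_def)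
    moreover have "dist x y < r/2" using y by auto
    ultimately have "dist x z < r" using dist_triangle_half_r[of y x r z] by (simp add: dist_commute)
    then show False using m r by auto
  qed
qed

text \<open>The quotient map is closed because saturations of closed sets are closed, and a closed
  continuous image of a normal space is normal, so the Tietze theorem applies in the quotient.
  Constancy of \<open>f\<close> on each \<open>E \<inter> K m\<close> is exactly what lets it
  descend to the image of \<open>E\<close>.\<close>

lemma Tietze_pieces_real:
  fixes f :: "'x \<Rightarrow> real"
  assumes "closed E" "continuous_on E f" "\<And>m. m \<in> I \<Longrightarrow> f constant_on (E \<inter> K m)"
    and T: "is_interval T" "T \<noteq> {}" "f ` E \<subseteq> T"
  shows "\<exists>F. collapsing I F \<and> (\<forall>x\<in>E. F x = f x) \<and> range F \<subseteq> T"
proof -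
  \<comment> \<open>\<open>p\<close> maps a point to its class; \<open>Y\<close> is the set of classes with the quotient topology.\<close>
  define p where "p = (\<lambda>x. {y. y = x \<or> (\<exists>m\<in>I. x \<in> K m \<and> y \<in> K m)})"
  define Y where "Y = topology (\<lambda>U. U \<subseteq> range p \<and> open (p -` U))"
  have p_eq: "p x = p y \<longleftrightarrow> x = y \<or> (\<exists>m\<in>I. x \<in> K m \<and> y \<in> K m)" for x y
    using piece_unique unfolding p_def by blast
  have "istopology (\<lambda>U. U \<subseteq> range p \<and> open (p -` U))"
    unfolding istopology_def by (auto simp: vimage_Union intro!: open_Int)
  then have openY: "openin Y U \<longleftrightarrow> U \<subseteq> range p \<and> open (p -` U)" for U
    by (simp add: Y_def)
  have "openin Y (range p)"
    by (simp add: openY vimage_def)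
  then have topY: "topspace Y = range p"
    by (metis openY openin_subset openin_topspace subset_antisym)
  have p_closed: "closedin Y (p ` C)" if "closed C" for C
  proof -
    have "p x \<in> p ` C \<longleftrightarrow> x \<in> saturate I C" for x
    proof -
      have "p x \<in> p ` C \<longleftrightarrow> (\<exists>c\<in>C. x = c \<or> (\<exists>m\<in>I. x \<in> K m \<and> c \<in> K m))"
        by (simp only: image_iff p_eq)
      also have "\<dots> \<longleftrightarrow> x \<in> saturate I C"
        by (fastforce simp: saturate_def)
      finally show ?thesis .
    qed
    then have "p -` (range p - p ` C) = - saturate I C" by auto
    then show ?thesis
      using closed_saturate[OF that, of I] by (auto simp: closedin_def topY openY open_closed)
  qed
  have contp: "continuous_map euclidean Y p"
    by (auto simp: continuous_map_def topY openY vimage_def)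
  have normal: "normal_space Y"
  proof (rule normal_space_continuous_closed_map_image[OF _ contp])
    show "normal_space (euclidean :: 'x topology)"
      by (simp add: metrizable_imp_normal_space metrizable_space_euclidean)
  qed (auto simp: closed_map_def topY p_closed)
  define f' where "f' = (\<lambda>P. f (SOME e. e \<in> E \<and> p e = P))"
  have f': "f' (p e) = f e" if "e \<in> E" for e
  proof -
    define e' where "e' = (SOME e'. e' \<in> E \<and> p e' = p e)"
    have "\<exists>e'. e' \<in> E \<and> p e' = p e"
      using that by blast
    then have "e' \<in> E \<and> p e' = p e"
      unfolding e'_def by (rule someI_ex)
    then have "e' \<in> E" and "e' = e \<or> (\<exists>m\<in>I. e' \<in> K m \<and> e \<in> K m)"
      using p_eq[of e' e] by auto
    then have "f e' = f e"
      using that assms(3) by (fastforce simp: constant_on_def)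
    then show ?thesis by (simp add: f'_def e'_def)
  qed
  \<comment> \<open>Closedness of \<open>p\<close> again: preimages of closed sets are images under
    \<open>p\<close> of closed subsets of \<open>E\<close>.\<close>
  have cont': "continuous_map (subtopology Y (p ` E)) euclideanreal f'"
    unfolding continuous_map_closedin
  proof (intro conjI allI impI)
    fix C :: "real set" assume "closedin euclideanreal C"
    then have "closed (E \<inter> f -` C)"
      using assms(1,2) by (simp add: continuous_on_closed_vimage Int_commute)
    then have "closedin Y (p ` (E \<inter> f -` C))" by (rule p_closed)
    moreover have "p ` (E \<inter> f -` C) = {x \<in> topspace (subtopology Y (p ` E)). f' x \<in> C}"
      by (auto simp: topY f')
    ultimately show "closedin (subtopology Y (p ` E)) {x \<in> topspace (subtopology Y (p ` E)). f' x \<in> C}"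
      by (metis (no_types, lifting) closedin_subset_topspace mem_Collect_eq subsetI topspace_subtopology Int_iff)
  qed auto
  have "f' ` p ` E \<subseteq> T" using T f' by auto
  from Tietze_extension_realinterval[OF normal p_closed[OF assms(1)] T(1,2) cont' this]
  obtain G where G: "continuous_map Y euclideanreal G" "G ` topspace Y \<subseteq> T"
    "\<And>x. x \<in> p ` E \<Longrightarrow> G x = f' x" by metis
  have "continuous_on UNIV (G \<circ> p)"
    using continuous_map_compose[OF contp G(1)] by simp
  moreover have "(G \<circ> p) constant_on K m" if "m \<in> I" for m
  proof -
    have "p x = p y" if "x \<in> K m" "y \<in> K m" for x y
      using p_eq[of x y] \<open>m \<in> I\<close> that by blast
    then show ?thesis by (metis comp_apply constant_on_def)
  qed
  moreover have "(G \<circ> p) x = f x" if "x \<in> E" for x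
    using that by (simp add: G(3) f')
  moreover have "range (G \<circ> p) \<subseteq> T"
    using G(2) by (auto simp: topY)
  ultimately show ?thesis unfolding collapsing_def by blast
qed

text \<open>Extending real and imaginary parts separately loses control of the range. Composing with
  the nearest-point map onto the closed convex set \<open>S\<close> restores it, as that map is
  continuous and fixes \<open>S\<close> pointwise.\<close>

lemma Tietze_pieces_complex:
  fixes f :: "'x \<Rightarrow> complex"
  assumes "closed E" "continuous_on E f" "\<And>m. m \<in> I \<Longrightarrow> f constant_on (E \<inter> K m)"
    and S: "closed S" "convex S" "S \<noteq> {}" "f ` E \<subseteq> S"
  shows "\<exists>F. collapsing I F \<and> (\<forall>x\<in>E. F x = f x) \<and> range F \<subseteq> S"
proof -
  have "\<exists>F. collapsing I F \<and> (\<forall>x\<in>E. F x = h (f x)) \<and> range F \<subseteq> UNIV"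
    if "continuous_on UNIV h" for h :: "complex \<Rightarrow> real"
    by (rule Tietze_pieces_real)
       (use assms(1-3) that in \<open>auto intro: continuous_on_compose2 constant_on_compose\<close>)
  from this[OF linear_continuous_on[OF bounded_linear_Re]] this[OF linear_continuous_on[OF bounded_linear_Im]]
  obtain F1 F2 where
      F1: "collapsing I F1" "\<And>x. x \<in> E \<Longrightarrow> F1 x = Re (f x)" and
      F2: "collapsing I F2" "\<And>x. x \<in> E \<Longrightarrow> F2 x = Im (f x)"
    by auto
  define F where "F = (\<lambda>x. closest_point S (Complex (F1 x) (F2 x)))"
  have 1: "continuous_on UNIV (\<lambda>x. Complex (F1 x) (F2 x))"
    using F1(1) F2(1) by (auto simp: collapsing_def Complex_eq intro!: continuous_intros)
  have 2: "continuous_on UNIV (closest_point S)"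
    using S by (intro continuous_on_closest_point)
  have "continuous_on UNIV F"
    unfolding F_def by (rule continuous_on_compose2[OF 2 1]) auto
  moreover have "F x = f x" if "x \<in> E" for x
    using that S by (auto simp: F_def F1(2) F2(2) intro!: closest_point_self)
  moreover have "F constant_on K m" if "m \<in> I" for m
    using F1(1) F2(1) that unfolding F_def collapsing_def by (auto intro: constant_on_compose2)
  moreover have "range F \<subseteq> S"
    using closest_point_in_set[OF S(1,3)] by (auto simp: F_def)
  ultimately show ?thesis unfolding collapsing_def by blast
qed

lemma continuous_on_separated_indicator:
  fixes S T :: "'a::topological_space set"
  assumes "closed S" "closed T" "S \<inter> T = {}"
  shows "continuous_on (S \<union> T) (\<lambda>x. if x \<in> T then b else c)"
  using assms by (subst Un_commute, intro continuous_on_cases) auto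

lemma Urysohn_pieces:
  assumes "closed S" "closed T" "S \<inter> T = {}"
    and "\<And>m. m \<in> I \<Longrightarrow> K m \<inter> S = {} \<or> K m \<inter> T = {}"
  shows "\<exists>d. cutoff I d \<and> (\<forall>x\<in>S. d x = 0) \<and> (\<forall>x\<in>T. d x = 1)"
proof -
  define u :: "'x \<Rightarrow> real" where "u = (\<lambda>x. if x \<in> T then 1 else 0)"
  have const: "u constant_on (S \<union> T) \<inter> K m" if "m \<in> I" for m
    using assms(4)[OF that] unfolding constant_on_def u_def by (metis IntE IntI UnE empty_iff)
  have contu: "continuous_on (S \<union> T) u"
    unfolding u_def by (rule continuous_on_separated_indicator[OF assms(1-3)])
  have "\<exists>d. collapsing I d \<and> (\<forall>x\<in>S \<union> T. d x = u x) \<and> range d \<subseteq> {0..1}"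
    by (rule Tietze_pieces_real[OF _ contu const])
       (use assms(1,2) in \<open>auto simp: u_def is_interval_cc\<close>)
  then obtain d where d: "collapsing I d" "\<forall>x\<in>S \<union> T. d x = u x" "range d \<subseteq> {0..1}"
    by blast
  show ?thesis
    by (rule exI[of _ d]) (use d assms(3) in \<open>auto simp: u_def cutoff_def image_subset_iff\<close>)
qed

lemma local_unit:
  assumes "closed F" "x \<notin> F" "\<And>m. m \<in> I \<Longrightarrow> x \<notin> K m"
  shows "\<exists>d. cutoff I d \<and> x \<in> interior (d -` {0}) \<and> (\<forall>y\<in>F. d y = 1)"
proof -
  have "x \<notin> saturate I F"
    using assms by (auto simp: saturate_def)
  then obtain r where r: "r > 0" "cball x r \<subseteq> - saturate I F"
    using closed_saturate[OF assms(1), of I] open_contains_cball by (metis ComplI open_Compl)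
  have "\<exists>d. cutoff I d \<and> (\<forall>y\<in>cball x r. d y = 0) \<and> (\<forall>y\<in>saturate I F. d y = 1)"
  proof (rule Urysohn_pieces)
    \<comment> \<open>As the pieces are disjoint, a collapsed piece meeting the saturation is
      contained in it, hence misses the ball.\<close>
    show "K m \<inter> cball x r = {} \<or> K m \<inter> saturate I F = {}" if "m \<in> I" for m
      using that r(2) piece_unique unfolding saturate_def by blast
  qed (use r closed_saturate[OF assms(1)] in auto)
  then obtain d where d: "cutoff I d" "\<forall>y\<in>cball x r. d y = 0" "\<forall>y\<in>saturate I F. d y = 1"
    by blast
  have "x \<in> interior (d -` {0})"
    by (rule interiorI[of "ball x r"]) (use r d(2) in auto)
  moreover have "F \<subseteq> saturate I F" by (auto simp: saturate_def)
  ultimately show ?thesis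
    using d by blast
qed

text \<open>The distance to \<open>P\<close> need not be constant on the pieces. Instead the
  complement of \<open>P\<close> is exhausted by the closed sets \<open>T j\<close>, and Urysohn
  functions for the pairs \<open>P\<close>, \<open>T j\<close> are summed with weights
  \<open>2^-(j+1)\<close>, whose total 1 keeps \<open>d\<close> below 1.\<close>

lemma zero_set_cutoff:
  assumes "closed P" "P \<noteq> {}" "\<And>m. m \<in> I \<Longrightarrow> K m \<inter> P = {} \<or> K m \<subseteq> P"
  shows "\<exists>d. cutoff I d \<and> (\<forall>y. d y = 0 \<longleftrightarrow> y \<in> P)"
proof -
  define T where "T = (\<lambda>j::nat. {y. infdist y P \<ge> 1 / real (Suc j)})"
  have "\<forall>j. \<exists>d. cutoff I d \<and> (\<forall>x\<in>P. d x = 0) \<and> (\<forall>x\<in>T j. d x = 1)"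
  proof
    fix j
    have cl: "closed (T j)"
      unfolding T_def by (intro closed_Collect_le continuous_intros)
    have "P \<inter> T j = {}"
      by (auto simp: T_def divide_le_0_iff)
    then have "K m \<inter> P = {} \<or> K m \<inter> T j = {}" if "m \<in> I" for m
      using assms(3)[OF that] by blast
    then show "\<exists>d. cutoff I d \<and> (\<forall>x\<in>P. d x = 0) \<and> (\<forall>x\<in>T j. d x = 1)"
      using Urysohn_pieces[OF \<open>closed P\<close> cl \<open>P \<inter> T j = {}\<close>, of I] by blast
  qed
  from choice[OF this] obtain e where e: "\<And>j. cutoff I (e j)"
      "\<And>j x. x \<in> P \<Longrightarrow> e j x = 0" "\<And>j x. x \<in> T j \<Longrightarrow> e j x = 1"
    by blast
  define t where "t = (\<lambda>j x. (1/2) ^ Suc j * e j x)"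
  have e01: "0 \<le> e j x" "e j x \<le> 1" for j x
    using e(1) by (auto simp: cutoff_def)
  have t_le: "t j x \<le> (1/2) ^ Suc j" for j x
    unfolding t_def by (rule mult_left_le[OF e01(2)]) simp
  have t_ge: "0 \<le> t j x" for j x
    unfolding t_def using e01(1) by simp
  have sm: "summable (\<lambda>j. (1/2::real) ^ Suc j)"
    by (rule sums_summable[OF power_half_series])
  have t_norm: "norm (t j x) \<le> (1/2) ^ Suc j" for j x
    using t_le[of j x] t_ge[of j x] by simp
  have summ: "summable (\<lambda>j. t j x)" for x
    by (rule summable_comparison_test'[OF sm t_norm])
  define d where "d = (\<lambda>x. \<Sum>j. t j x)"
  have "uniform_limit UNIV (\<lambda>n x. \<Sum>i<n. t i x) d sequentially"
    unfolding d_def by (rule Weierstrass_m_test[OF t_norm sm])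
  moreover have "continuous_on UNIV (\<lambda>x. \<Sum>i<n. t i x)" for n
    using e(1) by (auto simp: t_def cutoff_def collapsing_def intro!: continuous_intros)
  ultimately have "continuous_on UNIV d"
    by (intro uniform_limit_theorem) auto
  moreover have "d constant_on K m" if "m \<in> I" for m
  proof -
    have "d x = d y" if "x \<in> K m" "y \<in> K m" for x y
    proof -
      have "e j x = e j y" for j
        using e(1)[of j] \<open>m \<in> I\<close> that by (auto simp: cutoff_def collapsing_def constant_on_def)
      then show ?thesis by (simp add: d_def t_def)
    qed
    then show ?thesis unfolding constant_on_def by blast
  qed
  moreover have d0: "d y = 0" if "y \<in> P" for y
    using that by (simp add: d_def t_def e(2))
  moreover have dpos: "0 < d y" if "y \<notin> P" for y
  proof -
    have "infdist y P \<noteq> 0"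
      using that assms in_closed_iff_infdist_zero by blast
    then have "infdist y P > 0"
      using infdist_nonneg[of y P] by linarith
    then obtain j where "1 / real (Suc j) < infdist y P"
      using nat_approx_posE by blast
    then have "t j y > 0" by (simp add: t_def e(3) T_def)
    then show ?thesis
      unfolding d_def using suminf_pos2[OF summ t_ge] by blast
  qed
  moreover have "d y \<le> 1" for y
  proof -
    have "d y \<le> (\<Sum>j. (1/2) ^ Suc j)"
      unfolding d_def by (rule suminf_le[OF t_le summ sm])
    also have "\<dots> = 1" using sums_unique[OF power_half_series] by simp
    finally show ?thesis .
  qed
  moreover have "0 \<le> d y" for y
    using d0[of y] dpos[of y] by (cases "y \<in> P") auto
  ultimately have "cutoff I d"
    by (simp add: cutoff_def collapsing_def)
  moreover have "d y = 0 \<longleftrightarrow> y \<in> P" for y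
    using d0[of y] dpos[of y] by (cases "y \<in> P") auto
  ultimately show ?thesis by blast
qed

end

section \<open>Uniform algebras on compact spaces\<close>

lemma cmod_le_sup_norm:
  assumes "compact (UNIV :: 'a::topological_space set)" "continuous_on UNIV (f :: 'a \<Rightarrow> complex)"
  shows "cmod (f x) \<le> sup_norm f"
  unfolding sup_norm_def
proof (rule cSUP_upper)
  have "compact (range (\<lambda>x. cmod (f x)))"
    using assms by (intro compact_continuous_image continuous_intros)
  then show "bdd_above (range (\<lambda>x. cmod (f x)))"
    by (simp add: bounded_imp_bdd_above compact_imp_bounded)
qed simp

lemma sup_norm_le: "(\<And>x. cmod (f x) \<le> c) \<Longrightarrow> sup_norm f \<le> c"
  unfolding sup_norm_def by (rule cSUP_least) auto

lemma sup_norm_less: "(\<And>x. cmod (f x) \<le> c) \<Longrightarrow> c < \<epsilon> \<Longrightarrow> sup_norm f < \<epsilon>"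
  using sup_norm_le[of f c] by simp

locale compact_uniform_algebra =
  fixes B :: "('a::t2_space \<Rightarrow> complex) set"
  assumes compact: "compact (UNIV :: 'a set)"
    and algebra: "uniform_algebra B"
begin

lemma continuous: "f \<in> B \<Longrightarrow> continuous_on UNIV f"
  using algebra by (auto simp: uniform_algebra_def cont_funs_def)

lemma add: "f \<in> B \<Longrightarrow> g \<in> B \<Longrightarrow> (\<lambda>x. f x + g x) \<in> B"
  using algebra by (simp add: uniform_algebra_def)

lemma scale: "f \<in> B \<Longrightarrow> (\<lambda>x. c * f x) \<in> B"
  using algebra by (simp add: uniform_algebra_def)

lemma mult: "f \<in> B \<Longrightarrow> g \<in> B \<Longrightarrow> (\<lambda>x. f x * g x) \<in> B"
  using algebra by (simp add: uniform_algebra_def)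

lemma const: "(\<lambda>x. c) \<in> B"
  using algebra by (simp add: uniform_algebra_def)

lemma diff: "f \<in> B \<Longrightarrow> g \<in> B \<Longrightarrow> (\<lambda>x. f x - g x) \<in> B"
  using add[OF _ scale[of g "-1"]] by simp

lemma power: "f \<in> B \<Longrightarrow> (\<lambda>x. f x ^ n) \<in> B"
  by (induction n) (simp_all add: const mult)

lemma sum: "finite I \<Longrightarrow> (\<And>i. i \<in> I \<Longrightarrow> f i \<in> B) \<Longrightarrow> (\<lambda>x. \<Sum>i\<in>I. f i x) \<in> B"
  by (induction I rule: finite_induct) (simp_all add: const add)

lemma limit:
  assumes "continuous_on UNIV f" "\<And>\<epsilon>. \<epsilon> > 0 \<Longrightarrow> \<exists>g\<in>B. \<forall>x. cmod (f x - g x) \<le> \<epsilon>"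
  shows "f \<in> B"
proof -
  have "\<exists>g\<in>B. sup_norm (\<lambda>x. f x - g x) < \<epsilon>" if "\<epsilon> > 0" for \<epsilon>
    using assms(2)[of "\<epsilon>/2"] that sup_norm_less[of _ "\<epsilon>/2" \<epsilon>] by fastforce
  then have "f \<in> sup_closure B"
    using assms(1) by (simp add: sup_closure_def cont_funs_def)
  then show ?thesis
    using algebra by (auto simp: uniform_algebra_def)
qed

text \<open>Partial sums of the geometric series converge uniformly because \<open>r < 1\<close>,
  and \<open>B\<close> is uniformly closed. This supplies the inverses that make characters
  bounded.\<close>

lemma inverse_one_minus:
  assumes f: "f \<in> B" and r: "\<And>x. cmod (f x) \<le> r" "r < 1"
  shows "(\<lambda>x. 1 / (1 - f x)) \<in> B"
proof (rule limit)
  have r0: "r \<ge> 0" using r(1) norm_ge_zero order_trans by blast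
  have ne: "1 - f x \<noteq> 0" for x
    using r(1)[of x] r(2) by auto
  then show "continuous_on UNIV (\<lambda>x. 1 / (1 - f x))"
    using continuous[OF f] by (auto intro!: continuous_intros)
  fix \<epsilon> :: real assume \<epsilon>: "\<epsilon> > 0"
  obtain n where n: "r ^ n < \<epsilon> * (1 - r)"
    using real_arch_pow_inv[of "\<epsilon> * (1 - r)" r] \<epsilon> r(2) by auto
  have "cmod (1 / (1 - f x) - (\<Sum>i<n. f x ^ i)) \<le> \<epsilon>" for x
  proof -
    have "(\<Sum>i<n. f x ^ i) = (1 - f x ^ n) / (1 - f x)"
      using ne[of x] sum_gp_strict[of "f x" n] by simp
    then have "1 / (1 - f x) - (\<Sum>i<n. f x ^ i) = f x ^ n / (1 - f x)"
      using ne[of x] by (simp add: field_simps)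
    then have "cmod (1 / (1 - f x) - (\<Sum>i<n. f x ^ i)) = cmod (f x) ^ n / cmod (1 - f x)"
      by (simp add: norm_divide norm_power)
    also have "\<dots> \<le> r ^ n / (1 - r)"
    proof (rule frac_le)
      show "1 - r \<le> cmod (1 - f x)"
        using norm_triangle_ineq2[of 1 "f x"] r(1)[of x] by simp
    qed (use r r0 in \<open>auto intro: power_mono\<close>)
    also have "\<dots> \<le> \<epsilon>"
      using n r(2) by (simp add: pos_divide_le_eq)
    finally show ?thesis .
  qed
  then show "\<exists>g\<in>B. \<forall>x. cmod (1 / (1 - f x) - g x) \<le> \<epsilon>"
    by (intro bexI[of _ "\<lambda>x. \<Sum>i<n. f x ^ i"] sum power f) auto
qed

section \<open>Characters of a uniform algebra are contractive\<close>

context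
  fixes \<phi>
  assumes mult_lin: "mult_lin_functional B \<phi>" and nonzero: "\<exists>f\<in>B. \<phi> f \<noteq> 0"
begin

lemma functional_add: "f \<in> B \<Longrightarrow> g \<in> B \<Longrightarrow> \<phi> (\<lambda>x. f x + g x) = \<phi> f + \<phi> g"
  using mult_lin by (simp add: mult_lin_functional_def)

lemma functional_scale: "f \<in> B \<Longrightarrow> \<phi> (\<lambda>x. c * f x) = c * \<phi> f"
  using mult_lin by (simp add: mult_lin_functional_def)

lemma functional_mult: "f \<in> B \<Longrightarrow> g \<in> B \<Longrightarrow> \<phi> (\<lambda>x. f x * g x) = \<phi> f * \<phi> g"
  using mult_lin by (simp add: mult_lin_functional_def)

lemma functional_diff: "f \<in> B \<Longrightarrow> g \<in> B \<Longrightarrow> \<phi> (\<lambda>x. f x - g x) = \<phi> f - \<phi> g"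
  using functional_add[of f "\<lambda>x. -1 * g x"] functional_scale[of g "-1"] scale[of g "-1"] by simp

lemma functional_const: "\<phi> (\<lambda>x. c) = c"
proof -
  obtain f where f: "f \<in> B" "\<phi> f \<noteq> 0" using nonzero by blast
  have "\<phi> (\<lambda>x. 1) = 1"
    using functional_mult[OF f(1) const[of 1]] f(2) by simp
  then show ?thesis
    using functional_scale[OF const[of 1], of c] by simp
qed

text \<open>If \<open>\<phi> f\<close> exceeded the bound, \<open>1 - f / \<phi> f\<close> would be
  invertible in \<open>B\<close> although \<open>\<phi>\<close> sends it to 0. Continuity of
  characters is therefore automatic.\<close>

lemma functional_bound:
  assumes f: "f \<in> B" and c: "\<And>x. cmod (f x) \<le> c"
  shows "cmod (\<phi> f) \<le> c"
proof (rule ccontr)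
  assume "\<not> cmod (\<phi> f) \<le> c"
  moreover have "0 \<le> c" using c norm_ge_zero order_trans by blast
  ultimately have lt: "c < cmod (\<phi> f)" and ne: "\<phi> f \<noteq> 0" by auto
  define u where "u = (\<lambda>x. (1 / \<phi> f) * f x)"
  have u: "u \<in> B" unfolding u_def by (rule scale[OF f])
  have ub: "cmod (u x) \<le> c / cmod (\<phi> f)" for x
    using c[of x] ne by (simp add: u_def norm_mult norm_divide divide_right_mono)
  have u1: "c / cmod (\<phi> f) < 1" using lt ne by simp
  have inv: "(\<lambda>x. 1 / (1 - u x)) \<in> B"
    by (rule inverse_one_minus[OF u ub u1])
  have "1 - u x \<noteq> 0" for x
    using ub[of x] u1 by auto
  then have "(\<lambda>x. (1 - u x) * (1 / (1 - u x))) = (\<lambda>x. 1)" by auto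
  then have "\<phi> (\<lambda>x. 1 - u x) * \<phi> (\<lambda>x. 1 / (1 - u x)) = 1"
    using functional_mult[OF diff[OF const[of 1] u] inv] functional_const[of 1] by simp
  moreover have "\<phi> (\<lambda>x. 1 - u x) = 1 - \<phi> u"
    using functional_diff[OF const[of 1] u] functional_const[of 1] by simp
  moreover have "\<phi> u = 1"
    unfolding u_def using functional_scale[OF f, of "1 / \<phi> f"] ne by simp
  ultimately show False by simp
qed

end

section \<open>Ditkin's condition and strong regularity from bounded relative units\<close>

lemma ditkin_at_if_bounded_rel_units:
  assumes "bounded_rel_units_at_with B x C"
  shows "ditkin_at B x"
  unfolding ditkin_at_def
proof (intro ballI allI impI)
  fix f and \<epsilon> :: real assume f: "f \<in> M_ideal B x" and \<epsilon>: "\<epsilon> > 0"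
  \<comment> \<open>\<open>C\<close> is an arbitrary real here, so \<open>max\<close> secures a
    positive \<open>c\<close>; the extra 1 bounds \<open>g - 1\<close>. Where \<open>f\<close> is
    below \<open>\<delta>\<close> the error is at most \<open>c * \<delta> = \<epsilon>/2\<close>,
    and elsewhere \<open>g\<close> is 1.\<close>
  define c where "c = max C 0 + 1"
  have c: "c \<ge> 1" "C + 1 \<le> c" by (auto simp: c_def)
  define \<delta> where "\<delta> = \<epsilon> / (2 * c)"
  have \<delta>: "\<delta> > 0" using \<epsilon> c by (simp add: \<delta>_def)
  define F where "F = {y. cmod (f y) \<ge> \<delta>}"
  have cf: "continuous_on UNIV f" using f continuous by (simp add: M_ideal_def)
  then have "closed F"
    unfolding F_def by (intro closed_Collect_le continuous_intros)
  then have "compact F"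
    by (metis compact closed_Int_compact inf_top.right_neutral)
  moreover have "F \<subseteq> UNIV - {x}"
    using f \<delta> by (auto simp: F_def M_ideal_def)
  ultimately obtain g where g: "g \<in> J_ideal B x" "sup_norm g \<le> C" "g ` F \<subseteq> {1}"
    using assms unfolding bounded_rel_units_at_with_def by meson
  have cg: "continuous_on UNIV g" using g continuous by (simp add: J_ideal_def)
  have "cmod (g y * f y - f y) \<le> \<epsilon> / 2" for y
  proof (cases "y \<in> F")
    case True
    then have "g y = 1" using g(3) by auto
    then show ?thesis using \<epsilon> by simp
  next
    case False
    have "cmod (g y) \<le> C" using cmod_le_sup_norm[OF compact cg, of y] g(2) by simp
    then have "cmod (g y - 1) \<le> c"
      using norm_triangle_ineq4[of "g y" 1] c by simp
    moreover have "cmod (f y) \<le> \<delta>" using False by (simp add: F_def)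
    moreover have "g y * f y - f y = (g y - 1) * f y" by (simp add: algebra_simps)
    ultimately have "cmod (g y * f y - f y) \<le> c * \<delta>"
      using c by (simp add: norm_mult mult_mono)
    also have "\<dots> = \<epsilon> / 2" using c by (simp add: \<delta>_def)
    finally show ?thesis .
  qed
  then show "\<exists>g\<in>J_ideal B x. sup_norm (\<lambda>y. g y * f y - f y) < \<epsilon>"
    using g(1) \<epsilon> by (intro bexI[of _ g] sup_norm_less[of _ "\<epsilon>/2"]) auto
qed

lemma strongly_regular_at_if_ditkin:
  assumes "ditkin_at B x"
  shows "strongly_regular_at B x"
  unfolding strongly_regular_at_def sup_closure_def
proof clarify
  fix f assume f: "f \<in> M_ideal B x"
  have fB: "f \<in> B" using f by (simp add: M_ideal_def)
  have "\<exists>g\<in>J_ideal B x. sup_norm (\<lambda>y. f y - g y) < \<epsilon>" if "\<epsilon> > 0" for \<epsilon>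
  proof -
    obtain g where g: "g \<in> J_ideal B x" "sup_norm (\<lambda>y. g y * f y - f y) < \<epsilon>"
      using assms f \<open>\<epsilon> > 0\<close> unfolding ditkin_at_def by blast
    \<comment> \<open>The product inherits the zero neighborhood of \<open>g\<close>, so it lies in
      \<open>J_ideal B x\<close> and is itself the approximant of \<open>f\<close>.\<close>
    have "interior (g -` {0}) \<subseteq> interior ((\<lambda>y. g y * f y) -` {0})"
      by (rule interior_mono) auto
    then have "(\<lambda>y. g y * f y) \<in> J_ideal B x"
      using g(1) mult[of g f] fB by (auto simp: J_ideal_def)
    moreover have "sup_norm (\<lambda>y. f y - g y * f y) = sup_norm (\<lambda>y. g y * f y - f y)"
      by (simp add: sup_norm_def norm_minus_commute)
    ultimately show ?thesis
      using g(2) by (intro bexI[of _ "\<lambda>y. g y * f y"]) auto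
  qed
  then show "f \<in> cont_funs \<and> (\<forall>\<epsilon>>0. \<exists>g\<in>J_ideal B x. sup_norm (\<lambda>y. f y - g y) < \<epsilon>)"
    using continuous[OF fB] by (simp add: cont_funs_def)
qed

end

section \<open>The algebra of a null family of copies\<close>

locale inserted_algebra = null_family K + A: compact_uniform_algebra A
  for K :: "nat \<Rightarrow> 'x::metric_space set" and A :: "('k::t2_space \<Rightarrow> complex) set" +
  fixes h :: "nat \<Rightarrow> 'x \<Rightarrow> 'k" and g :: "nat \<Rightarrow> 'k \<Rightarrow> 'x"
  assumes homeo: "homeomorphism (K n) UNIV (h n) (g n)"
begin

abbreviation B where "B \<equiv> tilde_algebra A K h"

section \<open>Membership in the algebra and extension from a piece\<close>

lemma g_in: "g n k \<in> K n"
  using homeo[of n] by (auto simp: homeomorphism_def)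

lemma h_g: "h n (g n k) = k"
  using homeo[of n] by (auto simp: homeomorphism_def)

lemma g_h: "x \<in> K n \<Longrightarrow> g n (h n x) = x"
  using homeo[of n] by (auto simp: homeomorphism_def)

lemma cont_g: "continuous_on UNIV (g n)"
  using homeo[of n] by (auto simp: homeomorphism_def)

lemma cont_h: "continuous_on (K n) (h n)"
  using homeo[of n] by (auto simp: homeomorphism_def)

lemma g_eq_iff: "g n k = g n k' \<longleftrightarrow> k = k'"
  using h_g by metis

lemma piece_nonempty: "K n \<noteq> {}"
  using g_in by blast

lemma continuous_comp_g: "continuous_on UNIV f \<Longrightarrow> continuous_on UNIV (\<lambda>k. f (g n k))"
  by (rule continuous_on_compose2[OF _ cont_g]) auto

text \<open>Pulling back along the total map \<open>g n\<close> turns restrictions to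
  \<open>K n\<close> into elements of \<open>A\<close>, so \<open>restrict\<close> and
  \<open>h n\<close> disappear from membership proofs.\<close>

lemma tilde_iff: "f \<in> B \<longleftrightarrow> continuous_on UNIV f \<and> (\<forall>n. (\<lambda>k. f (g n k)) \<in> A)"
proof -
  have "restrict f (K n) \<in> transport_algebra A (K n) (h n) \<longleftrightarrow> (\<lambda>k. f (g n k)) \<in> A" for n
  proof
    assume "restrict f (K n) \<in> transport_algebra A (K n) (h n)"
    then obtain a where a: "a \<in> A" "restrict f (K n) = restrict (a \<circ> h n) (K n)"
      by (auto simp: transport_algebra_def)
    have "f (g n k) = a k" for k
      using fun_cong[OF a(2), of "g n k"] g_in[of n k] h_g[of n k] by simp
    then have "(\<lambda>k. f (g n k)) = a" by blast
    then show "(\<lambda>k. f (g n k)) \<in> A" using a(1) by simp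
  next
    assume a: "(\<lambda>k. f (g n k)) \<in> A"
    have "restrict f (K n) = restrict ((\<lambda>k. f (g n k)) \<circ> h n) (K n)"
      by (rule restrict_ext) (simp add: g_h)
    then show "restrict f (K n) \<in> transport_algebra A (K n) (h n)"
      using a unfolding transport_algebra_def by blast
  qed
  then show ?thesis by (simp add: tilde_algebra_def cont_funs_def)
qed

lemma tilde_continuous: "f \<in> B \<Longrightarrow> continuous_on UNIV f"
  by (simp add: tilde_iff)

lemma comp_g_in: "f \<in> B \<Longrightarrow> (\<lambda>k. f (g n k)) \<in> A"
  by (simp add: tilde_iff)

lemma collapsing_comp_g:
  assumes "collapsing I F" "n \<in> I" shows "\<exists>c. (\<lambda>k. F (g n k)) = (\<lambda>k. c)"
proof -
  obtain c where "\<And>x. x \<in> K n \<Longrightarrow> F x = c"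
    using assms by (auto simp: collapsing_def constant_on_def)
  then show ?thesis using g_in by blast
qed

lemma tilde_collapsingI:
  assumes "collapsing I F" "\<And>n. n \<notin> I \<Longrightarrow> (\<lambda>k. F (g n k)) \<in> A"
  shows "F \<in> B"
proof -
  have "(\<lambda>k. F (g n k)) \<in> A" for n
  proof (cases "n \<in> I")
    case True
    from collapsing_comp_g[OF assms(1) this] show ?thesis
      using A.const by auto
  qed (rule assms(2))
  then show ?thesis using assms(1) by (simp add: tilde_iff collapsing_def)
qed

text \<open>On a collapsed piece the cutoff is a scalar, so the product stays in the linear space
  \<open>A\<close>; only the pieces left intact have to be checked.\<close>

lemma tilde_cutoff_mult:
  assumes f: "f \<in> B" and d: "cutoff I d"
    and out: "\<And>n. n \<notin> I \<Longrightarrow> (\<lambda>k. complex_of_real (d (g n k)) * f (g n k)) \<in> A"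
  shows "(\<lambda>x. complex_of_real (d x) * f x) \<in> B"
proof -
  have cd: "collapsing I d" using d by (simp add: cutoff_def)
  have "(\<lambda>k. complex_of_real (d (g n k)) * f (g n k)) \<in> A" for n
  proof (cases "n \<in> I")
    case True
    then obtain c where "(\<lambda>k. d (g n k)) = (\<lambda>k. c)"
      using collapsing_comp_g[OF cd] by blast
    then have "(\<lambda>k. complex_of_real (d (g n k)) * f (g n k)) = (\<lambda>k. complex_of_real c * f (g n k))"
      by metis
    then show ?thesis using A.scale[OF comp_g_in[OF f]] by simp
  qed (rule out)
  then show ?thesis
    using tilde_continuous[OF f] cd by (auto simp: tilde_iff collapsing_def intro!: continuous_intros)
qed

lemma cutoff_in_tilde:
  assumes "cutoff UNIV d" shows "(\<lambda>x. complex_of_real (d x)) \<in> B"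
proof (rule tilde_collapsingI[of UNIV])
  show "collapsing UNIV (\<lambda>x. complex_of_real (d x))"
    by (rule collapsing_complex_of_real[OF cutoff_collapsing[OF assms]])
qed simp

text \<open>Prescribing one single value \<open>c\<close> on \<open>T\<close> makes the data
  constant on every other piece, for \<open>T \<union> K n\<close> meets such a piece only inside
  \<open>T\<close>. Taking a disc for \<open>S\<close> carries norm bounds over to the
  extension.\<close>

lemma extension:
  assumes a: "a \<in> A" and T: "closed T" "\<And>x. x \<in> T \<Longrightarrow> x \<in> K n \<Longrightarrow> a (h n x) = c"
    and S: "closed S" "convex S" "range a \<subseteq> S" "c \<in> S"
  shows "\<exists>F\<in>B. collapsing (-{n}) F \<and> (\<forall>k. F (g n k) = a k) \<and> (\<forall>x\<in>T. F x = c) \<and> range F \<subseteq> S"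
proof -
  define f where "f = (\<lambda>x. if x \<in> T then c else a (h n x))"
  have "continuous_on (K n) (\<lambda>x. a (h n x))"
    by (rule continuous_on_compose2[OF A.continuous[OF a] cont_h]) auto
  then have "continuous_on (T \<union> K n) f"
    unfolding f_def using T by (intro continuous_on_cases closed_piece) auto
  moreover have "f constant_on (T \<union> K n) \<inter> K m" if "m \<in> -{n}" for m
  proof -
    have "f x = c" if "x \<in> (T \<union> K n) \<inter> K m" for x
      using that \<open>m \<in> -{n}\<close> piece_unique[of x m n] by (auto simp: f_def)
    then show ?thesis unfolding constant_on_def by blast
  qed
  ultimately have "\<exists>F. collapsing (-{n}) F \<and> (\<forall>x\<in>T \<union> K n. F x = f x) \<and> range F \<subseteq> S"
    by (rule Tietze_pieces_complex[rotated]) (use S T(1) closed_piece in \<open>auto simp: f_def\<close>)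
  then obtain F where F: "collapsing (-{n}) F" "\<forall>x\<in>T \<union> K n. F x = f x" "range F \<subseteq> S"
    by blast
  have Fg: "F (g n k) = a k" for k
    using F(2) T(2)[of "g n k"] g_in[of n k] h_g[of n k] by (auto simp: f_def)
  then have "F \<in> B"
    using a by (intro tilde_collapsingI[OF F(1)]) auto
  then show ?thesis
    using F Fg by (intro bexI[of _ F]) (auto simp: f_def)
qed

lemma bounded_extension:
  assumes "a \<in> A" "\<And>k. cmod (a k) \<le> c"
  shows "\<exists>F\<in>B. collapsing (-{n}) F \<and> (\<forall>k. F (g n k) = a k) \<and> (\<forall>x. cmod (F x) \<le> c)"
proof -
  \<comment> \<open>With \<open>T\<close> empty the prescribed value only has to lie in the disc;
    \<open>a undefined\<close> does, being a value of \<open>a\<close>.\<close>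
  have "\<exists>F\<in>B. collapsing (-{n}) F \<and> (\<forall>k. F (g n k) = a k) \<and> (\<forall>x\<in>{}. F x = a undefined) \<and> range F \<subseteq> cball 0 c"
    by (rule extension) (use assms in \<open>auto simp: image_subset_iff\<close>)
  then show ?thesis by (auto simp: image_subset_iff)
qed

lemma extension_exists:
  assumes "a \<in> A" shows "\<exists>F\<in>B. \<forall>k. F (g n k) = a k"
  using bounded_extension[OF assms cmod_le_sup_norm[OF A.compact A.continuous[OF assms]], of n] by blast

section \<open>Uniform algebra axioms, restriction to a piece, essentialness\<close>

lemma tilde_algebra: "uniform_algebra B"
  unfolding uniform_algebra_def
proof (intro conjI allI ballI impI)
  show "B \<subseteq> cont_funs" by (auto simp: tilde_iff cont_funs_def)
  show "(\<lambda>x. f x + g x) \<in> B" if "f \<in> B" "g \<in> B" for f g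
    using that A.add by (auto simp: tilde_iff intro!: continuous_intros)
  show "(\<lambda>x. c * f x) \<in> B" if "f \<in> B" for f c
    using that A.scale by (auto simp: tilde_iff intro!: continuous_intros)
  show "(\<lambda>x. f x * g x) \<in> B" if "f \<in> B" "g \<in> B" for f g
    using that A.mult by (auto simp: tilde_iff intro!: continuous_intros)
  show "(\<lambda>x. c) \<in> B" for c
    using A.const by (simp add: tilde_iff)
  show "sup_closure B \<subseteq> B"
  proof
    fix f assume "f \<in> sup_closure B"
    then have cf: "continuous_on UNIV f" and
      app: "\<And>\<epsilon>. \<epsilon> > 0 \<Longrightarrow> \<exists>u\<in>B. sup_norm (\<lambda>x. f x - u x) < \<epsilon>"
      by (auto simp: sup_closure_def cont_funs_def)
    have "(\<lambda>k. f (g n k)) \<in> A" for n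
    proof (rule A.limit[OF continuous_comp_g[OF cf]])
      fix \<epsilon> :: real assume "\<epsilon> > 0"
      then obtain u where u: "u \<in> B" "sup_norm (\<lambda>x. f x - u x) < \<epsilon>" using app by blast
      have "continuous_on UNIV (\<lambda>x. f x - u x)"
        using cf tilde_continuous[OF u(1)] by (intro continuous_intros)
      from cmod_le_sup_norm[OF compact_space this] have "cmod (f x - u x) \<le> \<epsilon>" for x
        using u(2) by (meson less_imp_le order_trans)
      then show "\<exists>a\<in>A. \<forall>k. cmod (f (g n k) - a k) \<le> \<epsilon>"
        by (intro bexI[OF _ comp_g_in[OF u(1), of n]]) simp
    qed
    then show "f \<in> B" using cf by (simp add: tilde_iff)
  qed
  show "\<exists>f\<in>B. f x \<noteq> f y" if "x \<noteq> y" for x y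
  proof (cases "\<exists>n. x \<in> K n \<and> y \<in> K n")
    case True
    then obtain n where n: "x \<in> K n" "y \<in> K n" by blast
    then have "h n x \<noteq> h n y" using \<open>x \<noteq> y\<close> g_h by metis
    then obtain a where a: "a \<in> A" "a (h n x) \<noteq> a (h n y)"
      using A.algebra unfolding uniform_algebra_def by blast
    obtain F where F: "F \<in> B" "\<And>k. F (g n k) = a k"
      using extension_exists[OF a(1)] by blast
    then have "F x \<noteq> F y" using a(2) n g_h by metis
    then show ?thesis using F(1) by blast
  next
    case False
    \<comment> \<open>No piece contains both points, so they remain distinct in the full
      quotient.\<close>
    then have "\<exists>d. cutoff UNIV d \<and> (\<forall>z\<in>{x}. d z = 0) \<and> (\<forall>z\<in>{y}. d z = 1)"
      using that by (intro Urysohn_pieces) auto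
    then obtain d where "cutoff UNIV d" "d x = 0" "d y = 1" by blast
    then show ?thesis
      by (intro bexI[OF _ cutoff_in_tilde]) auto
  qed
qed

sublocale B: compact_uniform_algebra B
  by standard (rule compact_space, rule tilde_algebra)

lemma restrict_tilde: "restrict_algebra B (K n) = transport_algebra A (K n) (h n)"
proof
  show "restrict_algebra B (K n) \<subseteq> transport_algebra A (K n) (h n)"
    by (auto simp: restrict_algebra_def tilde_algebra_def)
  show "transport_algebra A (K n) (h n) \<subseteq> restrict_algebra B (K n)"
  proof (clarsimp simp: transport_algebra_def)
    fix a assume "a \<in> A"
    then obtain F where F: "F \<in> B" "\<And>k. F (g n k) = a k"
      using extension_exists by blast
    have "restrict (a \<circ> h n) (K n) = restrict F (K n)"
      by (rule restrict_ext) (metis F(2) comp_apply g_h)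
    then show "restrict (a \<circ> h n) (K n) \<in> restrict_algebra B (K n)"
      using F(1) by (simp add: restrict_algebra_def)
  qed
qed

text \<open>A proper closed \<open>E\<close> misses a whole piece. If \<open>B\<close> contained all
  continuous functions vanishing on \<open>E\<close>, every continuous function on that piece would
  extend to an element of \<open>B\<close>, forcing \<open>A\<close> to be all of
  \<open>cont_funs\<close>.\<close>

lemma essential_tilde:
  assumes dense: "\<And>U. open U \<Longrightarrow> U \<noteq> {} \<Longrightarrow> \<exists>n. K n \<subseteq> U"
    and nontrivial: "nontrivial_algebra A"
  shows "essential_algebra B"
proof -
  have "E = UNIV" if E: "closed E" "contains_vanishing_on B E" for E
  proof (rule ccontr)
    assume "E \<noteq> UNIV"
    then obtain n where n: "K n \<subseteq> - E"
      using dense[of "- E"] E(1) by (auto simp: open_Compl)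
    have "a \<in> A" if a: "continuous_on UNIV a" for a
    proof -
      define f where "f = (\<lambda>x. if x \<in> E then 0 else a (h n x))"
      have "continuous_on (K n) (\<lambda>x. a (h n x))"
        by (rule continuous_on_compose2[OF a cont_h]) auto
      then have "continuous_on (E \<union> K n) f"
        unfolding f_def using E(1) n by (intro continuous_on_cases closed_piece) auto
      \<comment> \<open>Nothing is collapsed: \<open>F\<close> enters \<open>B\<close> by vanishing
        on \<open>E\<close>, not by its values on the pieces.\<close>
      then have "\<exists>F. collapsing {} F \<and> (\<forall>x\<in>E \<union> K n. F x = f x) \<and> range F \<subseteq> UNIV"
        by (rule Tietze_pieces_complex[rotated]) (use E(1) closed_piece in auto)
      then obtain F where F: "continuous_on UNIV F" "\<And>x. x \<in> E \<union> K n \<Longrightarrow> F x = f x"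
        by (auto simp: collapsing_def)
      then have "F \<in> B"
        using E(2) by (simp add: contains_vanishing_on_def cont_funs_def f_def)
      moreover have "F (g n k) = a k" for k
        using F(2)[of "g n k"] g_in[of n k] n by (auto simp: f_def h_g)
      ultimately show ?thesis using comp_g_in[of F n] by simp
    qed
    then have "A = cont_funs"
      using A.continuous by (auto simp: cont_funs_def)
    then show False using nontrivial by (simp add: nontrivial_algebra_def)
  qed
  moreover have "contains_vanishing_on B UNIV"
    using B.const[of 0] by (auto simp: contains_vanishing_on_def fun_eq_iff[symmetric])
  ultimately show ?thesis
    by (auto simp: essential_algebra_def is_essential_set_def)
qed

section \<open>Naturality: characters on a piece and on the full quotient\<close>

lemma vanishing_off_piece:
  assumes "x \<notin> K n" shows "\<exists>f\<in>B. f x = 1 \<and> (\<forall>y\<in>K n. f y = 0)"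
proof -
  obtain F where "F \<in> B" "\<forall>k. F (g n k) = 0" "F x = 1"
    using extension[OF A.const[of 0], of "{x}" n 1 UNIV] assms by auto
  moreover have "F y = 0" if "y \<in> K n" for y
    using calculation(2) g_h[OF that] by metis
  ultimately show ?thesis by blast
qed

text \<open>A character of \<open>A\<close> composed with restriction to a piece is a character of
  \<open>B\<close>, hence evaluation at some \<open>x\<close>. This \<open>x\<close> lies on the
  piece, since a function of \<open>B\<close> vanishing on the piece can take the value 1 at any
  given point outside it. Piece 0 is an arbitrary choice.\<close>

lemma natural_if_tilde:
  assumes "natural_algebra B" shows "natural_algebra A"
  unfolding natural_algebra_def
proof (intro allI impI, elim conjE)
  fix \<phi> assume \<phi>: "mult_lin_functional A \<phi>" and nz: "\<exists>a\<in>A. \<phi> a \<noteq> 0"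
  define \<psi> where "\<psi> = (\<lambda>f. \<phi> (\<lambda>k. f (g 0 k)))"
  have "mult_lin_functional B \<psi>"
    using \<phi> comp_g_in unfolding mult_lin_functional_def \<psi>_def by simp
  moreover have "\<psi> (\<lambda>x. 1) \<noteq> 0"
    using A.functional_const[OF \<phi> nz, of 1] by (simp add: \<psi>_def)
  ultimately obtain x where x: "\<And>f. f \<in> B \<Longrightarrow> \<psi> f = f x"
    using assms B.const[of 1] unfolding natural_algebra_def by metis
  have "x \<in> K 0"
  proof (rule ccontr)
    assume "x \<notin> K 0"
    then obtain f where f: "f \<in> B" "f x = 1" "\<forall>y\<in>K 0. f y = 0"
      using vanishing_off_piece by blast
    then have "\<psi> f = \<phi> (\<lambda>k. 0)" using g_in by (simp add: \<psi>_def)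
    then show False
      using x[OF f(1)] f(2) A.functional_const[OF \<phi> nz, of 0] by simp
  qed
  have "\<phi> a = a (h 0 x)" if "a \<in> A" for a
  proof -
    obtain F where F: "F \<in> B" "\<And>k. F (g 0 k) = a k"
      using extension_exists[OF \<open>a \<in> A\<close>] by blast
    have "\<phi> a = \<psi> F" by (simp add: \<psi>_def F(2))
    also have "\<dots> = F x" by (rule x[OF F(1)])
    also have "\<dots> = a (h 0 x)" using F(2) g_h[OF \<open>x \<in> K 0\<close>] by metis
    finally show ?thesis .
  qed
  then show "\<exists>k. \<forall>a\<in>A. \<phi> a = a k" by blast
qed

context
  fixes \<phi>
  assumes mult_lin: "mult_lin_functional B \<phi>" and nonzero: "\<exists>f\<in>B. \<phi> f \<noteq> 0"
begin

lemma collapsing_tilde: "collapsing UNIV F \<Longrightarrow> F \<in> B"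
  by (rule tilde_collapsingI) auto

text \<open>\<open>B\<close> need not be closed under conjugation, but the functions constant on all
  pieces are, so \<open>d * cnj d\<close> lies in \<open>B\<close> and in the kernel. Adding such
  squares turns nonvanishing of some \<open>d\<close> into positivity of \<open>t\<close>.\<close>

lemma sum_of_squares_in_kernel:
  assumes "finite D" "\<And>d. d \<in> D \<Longrightarrow> collapsing UNIV d \<and> \<phi> d = 0"
  shows "\<exists>t :: 'x \<Rightarrow> real. collapsing UNIV t \<and> \<phi> (\<lambda>x. complex_of_real (t x)) = 0 \<and>
    (\<forall>x. t x \<ge> 0 \<and> (\<forall>d\<in>D. d x \<noteq> 0 \<longrightarrow> t x > 0))"
  using assms
proof (induction D rule: finite_induct)
  case empty
  then show ?case
    using B.functional_const[OF mult_lin nonzero, of 0]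
    by (intro exI[of _ "\<lambda>x. 0"]) (auto simp: collapsing_def constant_on_def)
next
  case (insert d D)
  then obtain t :: "'x \<Rightarrow> real" where t: "collapsing UNIV t" "\<phi> (\<lambda>x. complex_of_real (t x)) = 0"
      "\<And>x. t x \<ge> 0" "\<And>x e. e \<in> D \<Longrightarrow> e x \<noteq> 0 \<Longrightarrow> t x > 0"
    by auto
  have d: "collapsing UNIV d" "\<phi> d = 0" using insert.prems by auto
  define t' where "t' = (\<lambda>x. t x + (cmod (d x))\<^sup>2)"
  have t': "collapsing UNIV t'"
    unfolding t'_def
    by (rule collapsing_combine[OF t(1) d(1)])
       (intro continuous_intros collapsing_continuous[OF t(1)] collapsing_continuous[OF d(1)])
  have cnj: "collapsing UNIV (\<lambda>x. cnj (d x))"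
    by (rule collapsing_compose[OF d(1)]) (intro continuous_intros collapsing_continuous[OF d(1)])
  have tc: "collapsing UNIV (\<lambda>x. complex_of_real (t x))"
    by (rule collapsing_complex_of_real[OF t(1)])
  have "(\<lambda>x. complex_of_real (t' x)) = (\<lambda>x. complex_of_real (t x) + d x * cnj (d x))"
    by (simp add: t'_def complex_norm_square[symmetric])
  then have "\<phi> (\<lambda>x. complex_of_real (t' x)) = 0"
    using collapsing_tilde[OF tc] collapsing_tilde[OF cnj] collapsing_tilde[OF d(1)] d(2) t(2)
    by (simp add: B.functional_add[OF mult_lin nonzero] B.functional_mult[OF mult_lin nonzero] B.mult)
  moreover have "t' x \<ge> 0 \<and> (\<forall>e\<in>insert d D. e x \<noteq> 0 \<longrightarrow> t' x > 0)" for x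
    using t(3)[of x] t(4)[of _ x] by (auto simp: t'_def intro: add_pos_nonneg add_nonneg_pos)
  ultimately show ?case using t' by blast
qed

text \<open>The usual argument for characters of \<open>C(Y)\<close>, with \<open>Y\<close> the full
  quotient: if the kernel had no common zero, compactness would give finitely many kernel elements
  without one, hence a strictly positive and so invertible element of the kernel.\<close>

lemma functional_collapsing:
  obtains x where "\<And>F. collapsing UNIV F \<Longrightarrow> \<phi> F = F x"
proof -
  have "\<exists>x. \<forall>F. collapsing UNIV F \<longrightarrow> \<phi> F = F x"
  proof (rule ccontr)
    assume neg: "\<not> ?thesis"
    define N where "N = {F. collapsing UNIV F \<and> \<phi> F = 0}"
    have ex: "\<exists>F\<in>N. F x \<noteq> 0" for x
    proof -
      obtain F where F: "collapsing UNIV F" "\<phi> F \<noteq> F x" using neg by blast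
      have "\<phi> (\<lambda>y. F y - \<phi> F) = 0"
        using B.functional_diff[OF mult_lin nonzero collapsing_tilde[OF F(1)] B.const]
          B.functional_const[OF mult_lin nonzero] by simp
      moreover have "collapsing UNIV (\<lambda>y. F y - \<phi> F)"
        by (rule collapsing_compose[OF F(1), where u = "\<lambda>z. z - \<phi> F"])
           (intro continuous_intros collapsing_continuous[OF F(1)])
      ultimately show ?thesis
        using F(2) by (intro bexI[of _ "\<lambda>y. F y - \<phi> F"]) (auto simp: N_def)
    qed
    have op: "open {x. F x \<noteq> 0}" if "F \<in> N" for F
      using that by (auto simp: N_def collapsing_def intro!: open_Collect_neq)
    have "UNIV \<subseteq> (\<Union>F\<in>N. {x. F x \<noteq> 0})" using ex by blast
    then obtain D where D: "D \<subseteq> N" "finite D" "UNIV \<subseteq> (\<Union>F\<in>D. {x. F x \<noteq> 0})"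
      using compactE_image[OF compact_space, of N "\<lambda>F. {x. F x \<noteq> 0}"] op by metis
    obtain t :: "'x \<Rightarrow> real" where t: "collapsing UNIV t" "\<phi> (\<lambda>x. complex_of_real (t x)) = 0"
      "\<forall>x. t x \<ge> 0 \<and> (\<forall>d\<in>D. d x \<noteq> 0 \<longrightarrow> t x > 0)"
      using sum_of_squares_in_kernel[of D] D by (auto simp: N_def)
    have pos: "t x \<noteq> 0" for x
    proof -
      obtain F where "F \<in> D" "F x \<noteq> 0" using D(3) by blast
      then show ?thesis using t(3) by (metis less_irrefl)
    qed
    have tc: "collapsing UNIV (\<lambda>x. complex_of_real (t x))"
      by (rule collapsing_complex_of_real[OF t(1)])
    have ti: "collapsing UNIV (\<lambda>x. complex_of_real (1 / t x))"
      by (rule collapsing_compose[OF t(1)])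
         (use pos in \<open>auto intro!: continuous_intros collapsing_continuous[OF t(1)]\<close>)
    have "(\<lambda>x. complex_of_real (t x) * complex_of_real (1 / t x)) = (\<lambda>x. 1)"
      using pos by (simp flip: of_real_mult)
    then have "\<phi> (\<lambda>x. 1) = 0"
      using B.functional_mult[OF mult_lin nonzero collapsing_tilde[OF tc] collapsing_tilde[OF ti]] t(2)
      by simp
    then show False using B.functional_const[OF mult_lin nonzero, of 1] by simp
  qed
  then show thesis using that by blast
qed

text \<open>\<open>P\<close> will be a point off the pieces or a whole piece, that is, one point of
  the full quotient. With \<open>d\<close> equal to 0 on \<open>P\<close> and 1 where
  \<open>f\<close> is not small, passing to \<open>(1 - d) * f\<close> leaves
  \<open>\<phi> f\<close> unchanged, as \<open>\<phi> d = d x = 0\<close>, and brings the norm below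
  \<open>\<epsilon>\<close>.\<close>

lemma functional_vanishing:
  assumes x: "\<And>F. collapsing UNIV F \<Longrightarrow> \<phi> F = F x"
    and P: "closed P" "x \<in> P" "\<And>m. K m \<inter> P = {} \<or> K m \<subseteq> P"
    and f: "f \<in> B" "\<And>y. y \<in> P \<Longrightarrow> f y = 0"
  shows "\<phi> f = 0"
proof -
  have "cmod (\<phi> f) \<le> 0 + \<epsilon>" if "\<epsilon> > 0" for \<epsilon>
  proof -
    define T where "T = {y. \<epsilon> \<le> cmod (f y)}"
    have T: "closed T"
      unfolding T_def using tilde_continuous[OF f(1)] by (intro closed_Collect_le continuous_intros)
    have PT: "P \<inter> T = {}" using f(2) that by (auto simp: T_def)
    have "\<exists>d. cutoff UNIV d \<and> (\<forall>x\<in>P. d x = 0) \<and> (\<forall>x\<in>T. d x = 1)"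
      by (rule Urysohn_pieces[OF P(1) T PT]) (use P(3) PT in blast)
    then obtain d where d: "cutoff UNIV d" "\<And>x. x \<in> P \<Longrightarrow> d x = 0" "\<And>x. x \<in> T \<Longrightarrow> d x = 1"
      by blast
    let ?d = "\<lambda>x. complex_of_real (d x)"
    have dB: "?d \<in> B" by (rule cutoff_in_tilde[OF d(1)])
    have "collapsing UNIV ?d"
      by (rule collapsing_complex_of_real[OF cutoff_collapsing[OF d(1)]])
    then have "\<phi> ?d = 0" using x d(2) P(2) by simp
    then have "\<phi> (\<lambda>y. ?d y * f y) = 0"
      using B.functional_mult[OF mult_lin nonzero dB f(1)] by simp
    then have "\<phi> f = \<phi> (\<lambda>y. f y - ?d y * f y)"
      using B.functional_diff[OF mult_lin nonzero f(1) B.mult[OF dB f(1)]] by simp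
    moreover have "cmod (f y - ?d y * f y) \<le> \<epsilon>" for y
    proof (cases "y \<in> T")
      case True
      then show ?thesis using d(3) that by simp
    next
      case False
      have "f y - ?d y * f y = complex_of_real (1 - d y) * f y" by (simp add: algebra_simps)
      moreover have "\<bar>1 - d y\<bar> \<le> 1" using d(1) by (auto simp: cutoff_def abs_le_iff)
      ultimately have "cmod (f y - ?d y * f y) \<le> 1 * cmod (f y)"
        by (simp only: norm_mult norm_of_real mult_right_mono norm_ge_zero)
      then show ?thesis using False by (simp add: T_def)
    qed
    ultimately show ?thesis
      using B.functional_bound[OF mult_lin nonzero B.diff[OF f(1) B.mult[OF dB f(1)]]] by simp
  qed
  then have "cmod (\<phi> f) \<le> 0" by (rule field_le_epsilon)
  then show ?thesis by simp
qed

lemma functional_evaluation: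
  assumes "natural_algebra A" shows "\<exists>x. \<forall>f\<in>B. \<phi> f = f x"
proof -
  obtain x where x: "\<And>F. collapsing UNIV F \<Longrightarrow> \<phi> F = F x"
    using functional_collapsing by blast
  show ?thesis
  proof (cases "\<exists>n. x \<in> K n")
    case False
    have "\<phi> f = f x" if f: "f \<in> B" for f
    proof -
      have "\<phi> (\<lambda>y. f y - f x) = 0"
        by (rule functional_vanishing[OF x, of "{x}"]) (use False f B.diff[OF f B.const] in auto)
      then show ?thesis
        using B.functional_diff[OF mult_lin nonzero f B.const] B.functional_const[OF mult_lin nonzero]
        by simp
    qed
    then show ?thesis by blast
  next
    case True
    then obtain n where n: "x \<in> K n" by blast
    have agree: "\<phi> f = \<phi> f'" if f: "f \<in> B" "f' \<in> B" "\<And>k. f (g n k) = f' (g n k)" for f f'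
    proof -
      have "f y = f' y" if "y \<in> K n" for y
        using f(3)[of "h n y"] g_h[OF that] by simp
      then have "\<phi> (\<lambda>y. f y - f' y) = 0"
        using n piece_unique B.diff[OF f(1,2)]
        by (intro functional_vanishing[OF x, of "K n"] closed_piece) auto
      then show ?thesis
        using B.functional_diff[OF mult_lin nonzero f(1,2)] by simp
    qed
    \<comment> \<open>The extensions are chosen without regard to linearity; by
      \<open>agree\<close>, \<open>\<phi>\<close> does not see the choice, which makes
      \<open>\<psi>\<close> linear and multiplicative.\<close>
    have "\<forall>a. \<exists>F. a \<in> A \<longrightarrow> F \<in> B \<and> (\<forall>k. F (g n k) = a k)"
      using extension_exists by blast
    then obtain e where e: "\<And>a. a \<in> A \<Longrightarrow> e a \<in> B" "\<And>a k. a \<in> A \<Longrightarrow> e a (g n k) = a k"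
      by metis
    define \<psi> where "\<psi> = (\<lambda>a. \<phi> (e a))"
    have \<psi>: "\<psi> (\<lambda>k. f (g n k)) = \<phi> f" if "f \<in> B" for f
      unfolding \<psi>_def using that e[OF comp_g_in[OF that]] by (intro agree) auto
    have "mult_lin_functional A \<psi>"
      unfolding mult_lin_functional_def
    proof (intro conjI ballI allI)
      fix a b c assume ab: "a \<in> A" "b \<in> A"
      show "\<psi> (\<lambda>k. a k + b k) = \<psi> a + \<psi> b"
        using \<psi>[OF B.add[OF e(1)[OF ab(1)] e(1)[OF ab(2)]]] e[OF ab(1)] e[OF ab(2)]
        by (simp add: B.functional_add[OF mult_lin nonzero] \<psi>_def)
      show "\<psi> (\<lambda>k. a k * b k) = \<psi> a * \<psi> b"
        using \<psi>[OF B.mult[OF e(1)[OF ab(1)] e(1)[OF ab(2)]]] e[OF ab(1)] e[OF ab(2)]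
        by (simp add: B.functional_mult[OF mult_lin nonzero] \<psi>_def)
    next
      fix a c assume a: "a \<in> A"
      show "\<psi> (\<lambda>k. c * a k) = c * \<psi> a"
        using \<psi>[OF B.scale[OF e(1)[OF a]], of c] e[OF a]
        by (simp add: B.functional_scale[OF mult_lin nonzero] \<psi>_def)
    qed
    moreover have "\<psi> (\<lambda>k. 1) \<noteq> 0"
      using \<psi>[OF B.const[of 1]] B.functional_const[OF mult_lin nonzero, of 1] by simp
    ultimately obtain k where k: "\<And>a. a \<in> A \<Longrightarrow> \<psi> a = a k"
      using assms A.const[of 1] unfolding natural_algebra_def by metis
    have "\<phi> f = f (g n k)" if "f \<in> B" for f
      using \<psi>[OF that] k[OF comp_g_in[OF that]] by simp
    then show ?thesis by blast
  qed
qed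

end

lemma natural_tilde_iff: "natural_algebra B \<longleftrightarrow> natural_algebra A"
  using natural_if_tilde functional_evaluation unfolding natural_algebra_def[of B] by blast

section \<open>Regularity and normality\<close>

lemma closed_image_g: "closed S \<Longrightarrow> closed (g n ` S)"
  by (metis A.compact closed_Int_compact compact_continuous_image compact_imp_closed
      cont_g continuous_on_subset inf_top.right_neutral subset_UNIV)

lemma closed_vimage_g: "closed S \<Longrightarrow> closed (g n -` S)"
  using continuous_closed_vimage[of S "g n"] cont_g continuous_on_eq_continuous_at[of UNIV "g n"] by auto

lemma separation_outside_pieces:
  assumes "closed S" "closed T" "S \<inter> T = {}" "\<And>m. K m \<inter> S = {} \<or> K m \<inter> T = {}"
  shows "\<exists>f\<in>B. (\<forall>x\<in>S. f x = 0) \<and> (\<forall>x\<in>T. f x = 1)"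
proof -
  obtain d where "cutoff UNIV d" "\<And>x. x \<in> S \<Longrightarrow> d x = 0" "\<And>x. x \<in> T \<Longrightarrow> d x = 1"
    using Urysohn_pieces[OF assms(1-3), of UNIV] assms(4) by blast
  then show ?thesis by (intro bexI[OF _ cutoff_in_tilde]) auto
qed

lemma regular_tilde_iff: "regular_on_space B \<longleftrightarrow> regular_on_space A"
proof
  assume reg: "regular_on_space B"
  show "regular_on_space A"
    unfolding regular_on_space_def
  proof (intro allI impI, elim conjE)
    fix E and k :: 'k assume E: "closed E" "k \<notin> E"
    then have "closed (g 0 ` E)" "g 0 k \<notin> g 0 ` E"
      using closed_image_g by (auto simp: g_eq_iff)
    then obtain f where "f \<in> B" "f (g 0 k) = 1" "f ` g 0 ` E \<subseteq> {0}"
      using reg unfolding regular_on_space_def by meson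
    then show "\<exists>a\<in>A. a k = 1 \<and> a ` E \<subseteq> {0}"
      by (intro bexI[OF _ comp_g_in[of f 0]]) auto
  qed
next
  assume reg: "regular_on_space A"
  show "regular_on_space B"
    unfolding regular_on_space_def
  proof (intro allI impI, elim conjE)
    fix E and x :: 'x assume E: "closed E" "x \<notin> E"
    show "\<exists>f\<in>B. f x = 1 \<and> f ` E \<subseteq> {0}"
    proof (cases "\<exists>n. x \<in> K n")
      case True
      then obtain n where n: "x \<in> K n" by blast
      have "h n x \<notin> g n -` E" using E(2) g_h[OF n] by simp
      then obtain a where a: "a \<in> A" "a (h n x) = 1" "a ` (g n -` E) \<subseteq> {0}"
        using reg closed_vimage_g[OF E(1)] unfolding regular_on_space_def by meson
      have "\<exists>F\<in>B. collapsing (-{n}) F \<and> (\<forall>k. F (g n k) = a k) \<and> (\<forall>x\<in>E. F x = 0) \<and> range F \<subseteq> UNIV"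
      proof (rule extension[OF a(1) E(1)])
        show "a (h n x) = 0" if "x \<in> E" "x \<in> K n" for x
          using a(3) that(1) g_h[OF that(2)] by (auto simp: image_subset_iff)
      qed auto
      then obtain F where F: "F \<in> B" "\<And>k. F (g n k) = a k" "\<And>x. x \<in> E \<Longrightarrow> F x = 0" by blast
      have "F x = 1" using F(2)[of "h n x"] a(2) g_h[OF n] by simp
      then show ?thesis using F by auto
    next
      case False
      then obtain f where "f \<in> B" "\<And>y. y \<in> E \<Longrightarrow> f y = 0" "f x = 1"
        using separation_outside_pieces[of E "{x}"] E by auto
      then show ?thesis by (intro bexI[of _ f]) auto
    qed
  qed
qed

lemma separated_closed_sets:
  fixes E F :: "'x set"
  assumes "closed E" "closed F" "E \<inter> F = {}"
  shows "\<exists>\<delta>>0. \<forall>x\<in>E. \<forall>y\<in>F. \<delta> \<le> dist x y"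
proof (cases "E = {} \<or> F = {}")
  case True
  then show ?thesis by (intro exI[of _ 1]) auto
next
  case False
  have "continuous_on E (\<lambda>x. infdist x F)" by (intro continuous_intros)
  then obtain x0 where x0: "x0 \<in> E" "\<And>x. x \<in> E \<Longrightarrow> infdist x0 F \<le> infdist x F"
    using continuous_attains_inf[OF compact_closed[OF assms(1)], of "\<lambda>x. infdist x F"] False by blast
  have "infdist x0 F \<noteq> 0"
    using x0(1) assms False in_closed_iff_infdist_zero[of F x0] by blast
  then have "infdist x0 F > 0"
    using infdist_nonneg[of x0 F] by linarith
  moreover have "infdist x0 F \<le> dist x y" if "x \<in> E" "y \<in> F" for x y
    using x0(2)[OF that(1)] infdist_le[OF that(2), of x] by linarith
  ultimately show ?thesis by blast
qed

text \<open>A piece meeting both \<open>E\<close> and \<open>F\<close> has diameter at least a fixed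
  \<open>\<delta> > 0\<close>, so the set \<open>N\<close> of such pieces is finite. Keeping these
  intact and collapsing the others leaves data constant on every collapsed piece, while on the
  pieces in \<open>N\<close> normality of \<open>A\<close> supplies the values.\<close>

lemma normal_on_space_tilde:
  assumes norm: "normal_on_space A"
  shows "normal_on_space B"
  unfolding normal_on_space_def
proof (intro allI impI, elim conjE)
  fix E F :: "'x set" assume EF: "closed E" "closed F" "E \<inter> F = {}"
  define N where "N = {n. K n \<inter> E \<noteq> {} \<and> K n \<inter> F \<noteq> {}}"
  obtain \<delta> where \<delta>: "\<delta> > 0" "\<And>x y. x \<in> E \<Longrightarrow> y \<in> F \<Longrightarrow> \<delta> \<le> dist x y"
    using separated_closed_sets[OF EF] by blast
  have "\<delta> \<le> diameter (K n)" if n: "n \<in> N" for n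
  proof -
    obtain x y where "x \<in> K n" "x \<in> E" "y \<in> K n" "y \<in> F" using n by (auto simp: N_def)
    then show ?thesis
      using \<delta>(2)[of x y] diameter_bounded_bound[OF compact_imp_bounded[OF compact_piece], of x n y]
      by simp
  qed
  then have finN: "finite N"
    using finite_large_pieces[OF \<delta>(1)] by (auto intro: rev_finite_subset)
  have "\<forall>n. \<exists>a\<in>A. a ` (g n -` E) \<subseteq> {0} \<and> a ` (g n -` F) \<subseteq> {1}"
  proof
    fix n
    have "g n -` E \<inter> g n -` F = {}" using EF(3) by auto
    then show "\<exists>a\<in>A. a ` (g n -` E) \<subseteq> {0} \<and> a ` (g n -` F) \<subseteq> {1}"
      using norm closed_vimage_g[OF EF(1)] closed_vimage_g[OF EF(2)]
      unfolding normal_on_space_def by meson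
  qed
  then obtain a where a: "\<And>n. a n \<in> A" "\<And>n k. g n k \<in> E \<Longrightarrow> a n k = 0" "\<And>n k. g n k \<in> F \<Longrightarrow> a n k = 1"
    unfolding image_subset_iff vimage_def by (metis mem_Collect_eq singletonD)
  \<comment> \<open>Elsewhere the values are junk; only those on \<open>E\<close>, \<open>F\<close>
    and the pieces in \<open>N\<close> are passed to the extension.\<close>
  define f where "f = (\<lambda>x. if x \<in> F then 1 else if x \<in> E then 0
    else let n = THE n. x \<in> K n in a n (h n x))"
  have fK: "f x = a n (h n x)" if "x \<in> K n" for x n
  proof -
    have "(THE n. x \<in> K n) = n" using that piece_unique by blast
    then show ?thesis
      using a(2)[of n "h n x"] a(3)[of n "h n x"] g_h[OF that] by (simp add: f_def)
  qed
  have "continuous_on (K n) f" for n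
  proof -
    have "continuous_on (K n) (\<lambda>x. a n (h n x))"
      by (rule continuous_on_compose2[OF A.continuous[OF a(1)] cont_h]) auto
    then show ?thesis by (simp cong: continuous_on_cong_simp add: fK)
  qed
  then have cN: "continuous_on (\<Union>n\<in>N. K n) f"
    by (intro continuous_on_closed_Union finN closed_piece)
  have "continuous_on (E \<union> F) (\<lambda>x. if x \<in> F then 1 else 0 :: complex)"
    by (rule continuous_on_separated_indicator[OF EF])
  then have cEF: "continuous_on (E \<union> F) f"
    by (rule continuous_on_eq) (use EF(3) in \<open>auto simp: f_def\<close>)
  have cf: "continuous_on ((E \<union> F) \<union> (\<Union>n\<in>N. K n)) f"
    by (rule continuous_on_closed_Un[OF _ _ cEF cN]) (use EF finN closed_piece in auto)
  have "\<exists>G. collapsing (-N) G \<and> (\<forall>x\<in>(E \<union> F) \<union> (\<Union>n\<in>N. K n). G x = f x) \<and> range G \<subseteq> UNIV"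
  proof (rule Tietze_pieces_complex[OF _ cf])
    show "closed ((E \<union> F) \<union> (\<Union>n\<in>N. K n))"
      using EF finN closed_piece by auto
    fix m assume m: "m \<in> -N"
    \<comment> \<open>Distinct pieces are disjoint, so a collapsed piece meets the domain only in
      \<open>E \<union> F\<close>, and by the choice of \<open>N\<close> in at most one of the two
      sets.\<close>
    have "((E \<union> F) \<union> (\<Union>n\<in>N. K n)) \<inter> K m \<subseteq> (E \<union> F) \<inter> K m"
      using m piece_unique by blast
    moreover have "f x = f y" if "x \<in> (E \<union> F) \<inter> K m" "y \<in> (E \<union> F) \<inter> K m" for x y
      using that m EF(3) by (auto simp: f_def N_def)
    ultimately show "f constant_on ((E \<union> F) \<union> (\<Union>n\<in>N. K n)) \<inter> K m"
      unfolding constant_on_def by blast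
  qed auto
  then obtain G where G: "collapsing (-N) G" "\<And>x. x \<in> (E \<union> F) \<union> (\<Union>n\<in>N. K n) \<Longrightarrow> G x = f x"
    by blast
  have "G \<in> B"
  proof (rule tilde_collapsingI[OF G(1)])
    fix n assume "n \<notin> -N"
    then have "G (g n k) = a n k" for k
      using G(2)[of "g n k"] g_in[of n k] fK[OF g_in[of n k]] by (auto simp: h_g)
    then show "(\<lambda>k. G (g n k)) \<in> A" using a(1)[of n] by simp
  qed
  then show "\<exists>f\<in>B. f ` E \<subseteq> {0} \<and> f ` F \<subseteq> {1}"
    using G(2) EF(3) by (intro bexI[of _ G]) (auto simp: f_def)
qed

lemma normal_on_space_if_tilde:
  assumes norm: "normal_on_space B"
  shows "normal_on_space A"
  unfolding normal_on_space_def
proof (intro allI impI, elim conjE)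
  fix E F :: "'k set" assume EF: "closed E" "closed F" "E \<inter> F = {}"
  then have "g 0 ` E \<inter> g 0 ` F = {}" by (auto simp: g_eq_iff)
  then obtain f where "f \<in> B" "f ` g 0 ` E \<subseteq> {0}" "f ` g 0 ` F \<subseteq> {1}"
    using norm EF closed_image_g unfolding normal_on_space_def by meson
  then show "\<exists>a\<in>A. a ` E \<subseteq> {0} \<and> a ` F \<subseteq> {1}"
    by (intro bexI[OF _ comp_g_in[of f 0]]) (auto simp: image_subset_iff)
qed

lemma normal_tilde_iff: "normal_algebra B \<longleftrightarrow> normal_algebra A"
  using normal_on_space_if_tilde normal_on_space_tilde natural_tilde_iff
  by (auto simp: normal_algebra_def)

section \<open>Peak points\<close>

lemma peak_cutoff:
  assumes "closed P" "P \<noteq> {}" "\<And>m. K m \<inter> P = {} \<or> K m \<subseteq> P"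
  shows "\<exists>d. cutoff UNIV d \<and> (\<forall>y\<in>P. d y = 1) \<and> (\<forall>y. y \<notin> P \<longrightarrow> d y < 1)"
proof -
  obtain d where d: "cutoff UNIV d" "\<And>y. d y = 0 \<longleftrightarrow> y \<in> P"
    using zero_set_cutoff[OF assms(1,2), of UNIV] assms(3) by blast
  have "collapsing UNIV (\<lambda>x. 1 - d x)"
    by (rule collapsing_compose[OF cutoff_collapsing[OF d(1)]])
       (intro continuous_intros collapsing_continuous[OF cutoff_collapsing[OF d(1)]])
  moreover have "0 \<le> d y" "d y \<le> 1" for y using d(1) by (auto simp: cutoff_def)
  ultimately have "cutoff UNIV (\<lambda>x. 1 - d x)" by (simp add: cutoff_def)
  moreover have "1 - d y < 1" if "y \<notin> P" for y
    using that d(2)[of y] \<open>0 \<le> d y\<close> by linarith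
  ultimately show ?thesis
    using d(2) by (intro exI[of _ "\<lambda>x. 1 - d x"]) auto
qed

lemma peak_point_outside:
  assumes "\<And>n. x \<notin> K n" shows "peak_point B x"
proof -
  obtain d where d: "cutoff UNIV d" "d x = 1" "\<And>y. y \<noteq> x \<Longrightarrow> d y < 1"
    using peak_cutoff[of "{x}"] assms by auto
  have "0 \<le> d y" for y using d(1) by (simp add: cutoff_def)
  then show ?thesis
    unfolding peak_point_def using d by (intro bexI[OF _ cutoff_in_tilde[OF d(1)]]) auto
qed

text \<open>Forward, a peaking function is restricted to the piece. Backward, the extension of a
  peaking function is only bounded by 1 off \<open>K n\<close>; a cutoff equal to 1 exactly on
  \<open>K n\<close> makes the inequality strict there.\<close>

lemma peak_point_piece_iff: "peak_point B (g n k) \<longleftrightarrow> peak_point A k"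
proof
  assume "peak_point B (g n k)"
  then obtain f where "f \<in> B" "f (g n k) = 1" "\<And>y. y \<noteq> g n k \<Longrightarrow> cmod (f y) < 1"
    by (auto simp: peak_point_def)
  then show "peak_point A k"
    unfolding peak_point_def by (intro bexI[OF _ comp_g_in[of f n]]) (auto simp: g_eq_iff)
next
  assume "peak_point A k"
  then obtain a where a: "a \<in> A" "a k = 1" "\<And>k'. k' \<noteq> k \<Longrightarrow> cmod (a k') < 1"
    by (auto simp: peak_point_def)
  have a1: "cmod (a k') \<le> 1" for k'
    using a(2) a(3)[of k'] by (cases "k' = k") auto
  obtain F where F: "F \<in> B" "\<And>k. F (g n k) = a k" "\<And>x. cmod (F x) \<le> 1"
    using bounded_extension[OF a(1) a1, of n] by blast
  have "K m \<inter> K n = {} \<or> K m \<subseteq> K n" for m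
    using piece_unique by blast
  then obtain d where d: "cutoff UNIV d" "\<And>y. y \<in> K n \<Longrightarrow> d y = 1" "\<And>y. y \<notin> K n \<Longrightarrow> d y < 1"
    using peak_cutoff[OF closed_piece piece_nonempty, of n] by blast
  define f where "f = (\<lambda>x. complex_of_real (d x) * F x)"
  have "f \<in> B"
    unfolding f_def by (rule tilde_cutoff_mult[OF F(1) d(1)]) simp
  moreover have "f (g n k) = 1"
    by (simp add: f_def d(2)[OF g_in] F(2) a(2))
  moreover have "cmod (f y) < 1" if "y \<noteq> g n k" for y
  proof (cases "y \<in> K n")
    case True
    then have "F y = a (h n y)" "h n y \<noteq> k" using F(2)[of "h n y"] g_h that by auto
    then show ?thesis using a(3) d(2)[OF True] by (simp add: f_def)
  next
    case False
    have d0: "0 \<le> d y" using d(1) by (simp add: cutoff_def)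
    have "cmod (f y) = d y * cmod (F y)" using d0 by (simp add: f_def norm_mult)
    also have "\<dots> \<le> d y * 1" by (rule mult_left_mono[OF F(3) d0])
    also have "\<dots> < 1" using d(3)[OF False] by simp
    finally show ?thesis .
  qed
  ultimately show "peak_point B (g n k)" unfolding peak_point_def by blast
qed

section \<open>Functions vanishing near a point: relative units, strong regularity, Ditkin's
  condition\<close>

lemma J_comp_g:
  assumes "f \<in> J_ideal B (g n k)" shows "(\<lambda>k. f (g n k)) \<in> J_ideal A k"
proof -
  have "open (g n -` interior (f -` {0}))"
    using cont_g by (intro open_vimage) auto
  then have "g n -` interior (f -` {0}) \<subseteq> interior ((\<lambda>k. f (g n k)) -` {0})"
    using interior_subset by (intro interior_maximal) auto
  then show ?thesis
    using assms comp_g_in by (auto simp: J_ideal_def)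
qed

text \<open>A point off the pieces is separated in the full quotient from any compact set not
  containing it, so a cutoff with values in \<open>[0,1]\<close> is already the relative unit; hence
  the bound 1.\<close>

lemma bounded_rel_units_at_outside:
  assumes "\<And>n. x \<notin> K n" shows "bounded_rel_units_at_with B x 1"
  unfolding bounded_rel_units_at_with_def
proof (intro allI impI, elim conjE)
  fix F assume F: "compact F" "F \<subseteq> UNIV - {x}"
  obtain d where d: "cutoff UNIV d" "x \<in> interior (d -` {0})" "\<And>y. y \<in> F \<Longrightarrow> d y = 1"
    using local_unit[of F x UNIV] F assms compact_imp_closed by blast
  let ?d = "\<lambda>x. complex_of_real (d x)"
  have "?d -` {0} = d -` {0}" by auto
  then have "?d \<in> J_ideal B x"
    using d cutoff_in_tilde[OF d(1)] by (simp add: J_ideal_def)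
  moreover have "sup_norm ?d \<le> 1"
    by (rule sup_norm_le) (use d(1) in \<open>auto simp: cutoff_def\<close>)
  ultimately show "\<exists>f\<in>J_ideal B x. sup_norm f \<le> 1 \<and> f ` F \<subseteq> {1}"
    using d(3) by (intro bexI[of _ ?d]) auto
qed

text \<open>
  The cutoff \<open>d\<close> varies on \<open>K n\<close> only where \<open>F\<close> vanishes, so multiplication by \<open>d\<close> does not
  change \<open>F\<close> on \<open>K n\<close> and keeps the product in the algebra.
\<close>
lemma localise:
  assumes F: "F \<in> B" "(\<lambda>k. F (g n k)) \<in> J_ideal A k" and T: "closed T" "g n k \<notin> T"
  shows "\<exists>d. (\<forall>x. 0 \<le> d x \<and> d x \<le> 1) \<and> (\<forall>x\<in>T. d x = 1) \<and>
    (\<forall>k. complex_of_real (d (g n k)) * F (g n k) = F (g n k)) \<and>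
    (\<lambda>x. complex_of_real (d x) * F x) \<in> J_ideal B (g n k)"
proof -
  define U where "U = interior ((\<lambda>k. F (g n k)) -` {0})"
  have U: "open U" "k \<in> U" "\<And>k'. k' \<in> U \<Longrightarrow> F (g n k') = 0"
    using F(2) interior_subset by (auto simp: U_def J_ideal_def)
  have "closed (T \<union> g n ` (- U))"
    using T(1) U(1) by (intro closed_Un closed_image_g) auto
  moreover have "g n k \<notin> T \<union> g n ` (- U)"
    using T(2) U(2) by (auto simp: g_eq_iff)
  moreover have "g n k \<notin> K m" if "m \<in> -{n}" for m
    using that g_in piece_unique by blast
  ultimately obtain d where d: "cutoff (-{n}) d" "g n k \<in> interior (d -` {0})"
      "\<And>y. y \<in> T \<union> g n ` (- U) \<Longrightarrow> d y = 1"
    using local_unit[of "T \<union> g n ` (- U)" "g n k" "-{n}"] by blast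
  have same: "complex_of_real (d (g n k')) * F (g n k') = F (g n k')" for k'
    using d(3)[of "g n k'"] U(3)[of k'] by (cases "k' \<in> U") auto
  have "(\<lambda>x. complex_of_real (d x) * F x) \<in> B"
  proof (rule tilde_cutoff_mult[OF F(1) d(1)])
    fix m assume "m \<notin> -{n}"
    then show "(\<lambda>k. complex_of_real (d (g m k)) * F (g m k)) \<in> A"
      using comp_g_in[OF F(1), of n] by (simp add: same)
  qed
  moreover have "interior (d -` {0}) \<subseteq> interior ((\<lambda>x. complex_of_real (d x) * F x) -` {0})"
    by (rule interior_mono) auto
  ultimately have "(\<lambda>x. complex_of_real (d x) * F x) \<in> J_ideal B (g n k)"
    using d(2) by (auto simp: J_ideal_def)
  then show ?thesis
    using d same by (intro exI[of _ d]) (auto simp: cutoff_def)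
qed

text \<open>Backward, the extension is prescribed to be 1 on \<open>T\<close> with values in the
  disc of radius \<open>C\<close>, which contains 1 because \<open>C \<ge> 1\<close>. The factor
  from \<open>localise\<close> creates the zero neighborhood in \<open>X\<close> without enlarging
  the norm or disturbing the values on \<open>T\<close>.\<close>

lemma bounded_rel_units_at_piece_iff:
  "bounded_rel_units_at_with B (g n k) C \<longleftrightarrow> bounded_rel_units_at_with A k C" if "C \<ge> 1"
proof
  assume b: "bounded_rel_units_at_with B (g n k) C"
  show "bounded_rel_units_at_with A k C"
    unfolding bounded_rel_units_at_with_def
  proof (intro allI impI, elim conjE)
    fix F assume F: "compact F" "F \<subseteq> UNIV - {k}"
    have "compact (g n ` F)"
      using F(1) cont_g by (meson compact_continuous_image continuous_on_subset subset_UNIV)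
    moreover have "g n ` F \<subseteq> UNIV - {g n k}" using F(2) by (auto simp: g_eq_iff)
    ultimately obtain f where f: "f \<in> J_ideal B (g n k)" "sup_norm f \<le> C" "f ` g n ` F \<subseteq> {1}"
      using b unfolding bounded_rel_units_at_with_def by meson
    have "continuous_on UNIV f" using f(1) by (simp add: J_ideal_def tilde_continuous)
    then have "cmod (f x) \<le> C" for x
      using cmod_le_sup_norm[OF compact_space, of f x] f(2) by simp
    then have "sup_norm (\<lambda>k. f (g n k)) \<le> C"
      by (intro sup_norm_le)
    then show "\<exists>f\<in>J_ideal A k. sup_norm f \<le> C \<and> f ` F \<subseteq> {1}"
      using f(3) by (intro bexI[OF _ J_comp_g[OF f(1)]]) auto
  qed
next
  assume b: "bounded_rel_units_at_with A k C"
  show "bounded_rel_units_at_with B (g n k) C"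
    unfolding bounded_rel_units_at_with_def
  proof (intro allI impI, elim conjE)
    fix T assume T: "compact T" "T \<subseteq> UNIV - {g n k}"
    have cT: "closed T" using T(1) compact_imp_closed by blast
    have "compact (g n -` T)"
      using closed_vimage_g[OF cT] A.compact by (metis closed_Int_compact inf_top.right_neutral)
    moreover have "g n -` T \<subseteq> UNIV - {k}" using T(2) by auto
    ultimately obtain a where a: "a \<in> J_ideal A k" "sup_norm a \<le> C" "a ` (g n -` T) \<subseteq> {1}"
      using b unfolding bounded_rel_units_at_with_def by meson
    have aA: "a \<in> A" using a(1) by (simp add: J_ideal_def)
    have aC: "cmod (a k) \<le> C" for k
      using cmod_le_sup_norm[OF A.compact A.continuous[OF aA], of k] a(2) by simp
    have "\<exists>F\<in>B. collapsing (-{n}) F \<and> (\<forall>k. F (g n k) = a k) \<and> (\<forall>x\<in>T. F x = 1) \<and> range F \<subseteq> cball 0 C"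
    proof (rule extension[OF aA cT])
      show "a (h n x) = 1" if "x \<in> T" "x \<in> K n" for x
        using a(3) that(1) g_h[OF that(2)] by (auto simp: image_subset_iff)
    qed (use aC \<open>C \<ge> 1\<close> in auto)
    then obtain F where F: "F \<in> B" "\<And>k. F (g n k) = a k" "\<And>x. x \<in> T \<Longrightarrow> F x = 1" "range F \<subseteq> cball 0 C"
      by blast
    have "(\<lambda>k. F (g n k)) \<in> J_ideal A k" "g n k \<notin> T" using a(1) T(2) by (auto simp add: F(2))
    from localise[OF F(1) this(1) cT this(2)] obtain d where d: "\<And>x. 0 \<le> d x \<and> d x \<le> 1"
      "\<And>x. x \<in> T \<Longrightarrow> d x = 1" "(\<lambda>x. complex_of_real (d x) * F x) \<in> J_ideal B (g n k)"
      by blast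
    have "cmod (complex_of_real (d x) * F x) \<le> C" for x
    proof -
      have "cmod (F x) \<le> C" using F(4) by (auto simp: image_subset_iff)
      then have "\<bar>d x\<bar> * cmod (F x) \<le> 1 * C"
        using d(1)[of x] \<open>C \<ge> 1\<close> by (intro mult_mono) auto
      then show ?thesis by (simp add: norm_mult)
    qed
    then have "sup_norm (\<lambda>x. complex_of_real (d x) * F x) \<le> C" by (rule sup_norm_le)
    then show "\<exists>f\<in>J_ideal B (g n k). sup_norm f \<le> C \<and> f ` T \<subseteq> {1}"
      using d(2) F(3) by (intro bexI[OF _ d(3)]) auto
  qed
qed

lemma strongly_regular_at_piece_iff: "strongly_regular_at B (g n k) \<longleftrightarrow> strongly_regular_at A k"
proof
  assume sr: "strongly_regular_at B (g n k)"
  show "strongly_regular_at A k"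
    unfolding strongly_regular_at_def sup_closure_def
  proof (intro subsetI CollectI conjI allI impI)
    fix a assume a: "a \<in> M_ideal A k"
    then have aA: "a \<in> A" by (simp add: M_ideal_def)
    then show "a \<in> cont_funs" using A.continuous by (simp add: cont_funs_def)
    fix \<epsilon> :: real assume "\<epsilon> > 0"
    obtain F where F: "F \<in> B" "\<And>k. F (g n k) = a k"
      using extension_exists[OF aA] by blast
    then have "F \<in> M_ideal B (g n k)" using a by (simp add: M_ideal_def)
    then have "F \<in> sup_closure (J_ideal B (g n k))"
      using sr by (auto simp: strongly_regular_at_def)
    then obtain G where G: "G \<in> J_ideal B (g n k)" "sup_norm (\<lambda>x. F x - G x) < \<epsilon>"
      using \<open>\<epsilon> > 0\<close> by (auto simp: sup_closure_def)
    have "continuous_on UNIV (\<lambda>x. F x - G x)"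
      using F(1) G(1) by (intro tilde_continuous B.diff) (simp_all add: J_ideal_def)
    from cmod_le_sup_norm[OF compact_space this]
    have "cmod (a k' - G (g n k')) \<le> sup_norm (\<lambda>x. F x - G x)" for k'
      using F(2) by metis
    then have "sup_norm (\<lambda>k. a k - G (g n k)) < \<epsilon>"
      using G(2) by (rule sup_norm_less)
    then show "\<exists>b\<in>J_ideal A k. sup_norm (\<lambda>x. a x - b x) < \<epsilon>"
      by (intro bexI[OF _ J_comp_g[OF G(1)]])
  qed
next
  assume sr: "strongly_regular_at A k"
  show "strongly_regular_at B (g n k)"
    unfolding strongly_regular_at_def sup_closure_def
  proof (intro subsetI CollectI conjI allI impI)
    fix f assume f: "f \<in> M_ideal B (g n k)"
    then have fB: "f \<in> B" by (simp add: M_ideal_def)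
    then show "f \<in> cont_funs" using tilde_continuous by (simp add: cont_funs_def)
    fix \<epsilon> :: real assume \<epsilon>: "\<epsilon> > 0"
    have "(\<lambda>k. f (g n k)) \<in> sup_closure (J_ideal A k)"
      using sr f comp_g_in by (auto simp: strongly_regular_at_def M_ideal_def)
    then obtain b where b: "b \<in> J_ideal A k" "sup_norm (\<lambda>k. f (g n k) - b k) < \<epsilon>/3"
      unfolding sup_closure_def using \<epsilon> by (auto dest!: spec[of _ "\<epsilon>/3"])
    have bA: "b \<in> A" using b(1) by (simp add: J_ideal_def)
    have diffA: "(\<lambda>k. b k - f (g n k)) \<in> A" by (rule A.diff[OF bA comp_g_in[OF fB]])
    have "cmod (b k' - f (g n k')) \<le> \<epsilon>/3" for k'
    proof -
      have "cmod (f (g n k') - b k') \<le> sup_norm (\<lambda>k. f (g n k) - b k)"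
        using A.continuous[OF A.diff[OF comp_g_in[OF fB] bA]] by (rule cmod_le_sup_norm[OF A.compact])
      then show ?thesis using b(2) by (simp add: norm_minus_commute)
    qed
    \<comment> \<open>The correction \<open>H\<close> makes \<open>f + H\<close> equal to
      \<open>b\<close> on the piece at a cost of \<open>\<epsilon>/3\<close> in norm; extending
      \<open>b\<close> directly would give no control of the distance to \<open>f\<close>
      elsewhere.\<close>
    from bounded_extension[OF diffA this] obtain H where
      H: "H \<in> B" "\<And>k. H (g n k) = b k - f (g n k)" "\<And>x. cmod (H x) \<le> \<epsilon>/3" by blast
    define f1 where "f1 = (\<lambda>x. f x + H x)"
    have f1: "f1 \<in> B" unfolding f1_def by (rule B.add[OF fB H(1)])
    have f1b: "f1 (g n k') = b k'" for k' by (simp add: f1_def H(2))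
    \<comment> \<open>Making \<open>f1\<close> vanish near the point changes it only off
      \<open>T\<close>, where it is below \<open>\<epsilon>/3\<close>. The two errors of
      \<open>\<epsilon>/3\<close> leave room for a strict inequality.\<close>
    define T where "T = {x. \<epsilon>/3 \<le> cmod (f1 x)}"
    have cT: "closed T"
      unfolding T_def using tilde_continuous[OF f1] by (intro closed_Collect_le continuous_intros)
    have "b k = 0" using b(1) interior_subset by (auto simp: J_ideal_def)
    then have nT: "g n k \<notin> T" using \<epsilon> by (simp add: T_def f1b)
    have "(\<lambda>k. f1 (g n k)) \<in> J_ideal A k" using b(1) by (simp add: f1b)
    from localise[OF f1 this cT nT] obtain d where d: "\<And>x. 0 \<le> d x \<and> d x \<le> 1"
      "\<And>x. x \<in> T \<Longrightarrow> d x = 1" "(\<lambda>x. complex_of_real (d x) * f1 x) \<in> J_ideal B (g n k)"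
      by blast
    have "cmod (f x - complex_of_real (d x) * f1 x) \<le> 2 * \<epsilon> / 3" for x
    proof -
      have "cmod (complex_of_real (1 - d x) * f1 x) \<le> \<epsilon>/3"
      proof (cases "x \<in> T")
        case True
        then show ?thesis using d(2) \<epsilon> by simp
      next
        case False
        have "\<bar>1 - d x\<bar> * cmod (f1 x) \<le> 1 * (\<epsilon>/3)"
          using False d(1)[of x] by (intro mult_mono) (auto simp: T_def)
        then show ?thesis by (simp only: norm_mult norm_of_real)
      qed
      moreover have "f x - complex_of_real (d x) * f1 x = complex_of_real (1 - d x) * f1 x - H x"
        by (simp add: f1_def algebra_simps)
      ultimately show ?thesis
        using norm_triangle_ineq4[of "complex_of_real (1 - d x) * f1 x" "H x"] H(3)[of x] by simp
    qed
    then have "sup_norm (\<lambda>x. f x - complex_of_real (d x) * f1 x) < \<epsilon>"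
      by (rule sup_norm_less) (use \<epsilon> in simp)
    then show "\<exists>u\<in>J_ideal B (g n k). sup_norm (\<lambda>x. f x - u x) < \<epsilon>"
      by (intro bexI[OF _ d(3)])
  qed
qed

lemma ditkin_at_piece_iff: "ditkin_at B (g n k) \<longleftrightarrow> ditkin_at A k"
proof
  assume dk: "ditkin_at B (g n k)"
  show "ditkin_at A k"
    unfolding ditkin_at_def
  proof (intro ballI allI impI)
    fix a and \<epsilon> :: real assume a: "a \<in> M_ideal A k" and "\<epsilon> > 0"
    then have aA: "a \<in> A" by (simp add: M_ideal_def)
    obtain F where F: "F \<in> B" "\<And>k. F (g n k) = a k"
      using extension_exists[OF aA] by blast
    then have "F \<in> M_ideal B (g n k)" using a by (simp add: M_ideal_def)
    then obtain G where G: "G \<in> J_ideal B (g n k)" "sup_norm (\<lambda>x. G x * F x - F x) < \<epsilon>"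
      using \<open>\<epsilon> > 0\<close> dk unfolding ditkin_at_def by blast
    have "continuous_on UNIV (\<lambda>x. G x * F x - F x)"
      using F(1) G(1) by (intro tilde_continuous B.diff B.mult) (simp_all add: J_ideal_def)
    from cmod_le_sup_norm[OF compact_space this]
    have "cmod (G (g n k') * a k' - a k') \<le> sup_norm (\<lambda>x. G x * F x - F x)" for k'
      using F(2) by metis
    then have "sup_norm (\<lambda>k. G (g n k) * a k - a k) < \<epsilon>"
      using G(2) by (rule sup_norm_less)
    then show "\<exists>b\<in>J_ideal A k. sup_norm (\<lambda>y. b y * a y - a y) < \<epsilon>"
      by (intro bexI[OF _ J_comp_g[OF G(1)]])
  qed
next
  assume dk: "ditkin_at A k"
  show "ditkin_at B (g n k)"
    unfolding ditkin_at_def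
  proof (intro ballI allI impI)
    fix f and \<epsilon> :: real assume f: "f \<in> M_ideal B (g n k)" and \<epsilon>: "\<epsilon> > 0"
    then have fB: "f \<in> B" by (simp add: M_ideal_def)
    have "(\<lambda>k. f (g n k)) \<in> M_ideal A k"
      using f comp_g_in by (auto simp: M_ideal_def)
    then obtain b where b: "b \<in> J_ideal A k" "sup_norm (\<lambda>k. b k * f (g n k) - f (g n k)) < \<epsilon>/3"
      using dk \<epsilon> unfolding ditkin_at_def by (meson divide_pos_pos zero_less_numeral)
    have bA: "b \<in> A" using b(1) by (simp add: J_ideal_def)
    have bf: "cmod (b k' * f (g n k') - f (g n k')) < \<epsilon>/3" for k'
      using cmod_le_sup_norm[OF A.compact A.continuous[OF A.diff[OF A.mult[OF bA comp_g_in[OF fB]]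
          comp_g_in[OF fB]]], of k'] b(2) by (rule order_le_less_trans)
    obtain G where G: "G \<in> B" "\<And>k. G (g n k) = b k"
      using extension_exists[OF bA] by blast
    \<comment> \<open>\<open>S\<close> is where \<open>G\<close> fails as an approximate unit for
      \<open>f\<close>. The strict bound on \<open>K n\<close> keeps \<open>S\<close> off the whole
      piece, so a cutoff constant on all pieces can separate the two.\<close>
    define S where "S = {x. \<epsilon>/3 \<le> cmod (G x * f x - f x)}"
    have cS: "closed S"
      unfolding S_def using tilde_continuous[OF G(1)] tilde_continuous[OF fB]
      by (intro closed_Collect_le continuous_intros)
    have SK: "S \<inter> K n = {}"
    proof -
      have "x \<notin> S" if "x \<in> K n" for x
        using bf[of "h n x"] G(2)[of "h n x"] g_h[OF that] by (simp add: S_def)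
      then show ?thesis by blast
    qed
    have "\<exists>e. cutoff UNIV e \<and> (\<forall>x\<in>S. e x = 0) \<and> (\<forall>x\<in>K n. e x = 1)"
      by (rule Urysohn_pieces[OF cS closed_piece SK]) (use SK piece_unique in blast)
    then obtain e where e: "cutoff UNIV e" "\<And>x. x \<in> S \<Longrightarrow> e x = 0" "\<And>x. x \<in> K n \<Longrightarrow> e x = 1"
      by blast
    \<comment> \<open>\<open>b\<close> works only on \<open>K n\<close>; \<open>e\<close> switches its extension \<open>G\<close> to \<open>1\<close> away from \<open>K n\<close>.\<close>
    define G1 where "G1 = (\<lambda>x. 1 + complex_of_real (e x) * (G x - 1))"
    have G1: "G1 \<in> B"
      unfolding G1_def
      by (rule B.add[OF B.const tilde_cutoff_mult[OF B.diff[OF G(1) B.const] e(1)]]) simp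
    have G1b: "G1 (g n k') = b k'" for k'
      by (simp add: G1_def e(3)[OF g_in] G(2))
    have G1f: "cmod (G1 x * f x - f x) \<le> \<epsilon>/3" for x
    proof -
      have eq: "G1 x * f x - f x = complex_of_real (e x) * (G x * f x - f x)"
        by (simp add: G1_def algebra_simps)
      show ?thesis
      proof (cases "x \<in> S")
        case True
        then show ?thesis using e(2) \<epsilon> by (simp only: eq) simp
      next
        case False
        have "0 \<le> e x" "e x \<le> 1" using e(1) by (auto simp: cutoff_def)
        then have "\<bar>e x\<bar> * cmod (G x * f x - f x) \<le> 1 * (\<epsilon>/3)"
          using False by (intro mult_mono) (auto simp: S_def)
        then show ?thesis by (simp only: eq norm_mult norm_of_real)
      qed
    qed
    \<comment> \<open>\<open>d\<close> may differ from 1 only off \<open>T\<close>, where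
      \<open>f\<close> is below \<open>\<epsilon>/3\<close>; the error of \<open>G1\<close> is
      another \<open>\<epsilon>/3\<close>, which the factor \<open>d \<le> 1\<close> does not
      increase.\<close>
    define T where "T = {x. \<epsilon>/3 \<le> cmod (f x)}"
    have cT: "closed T"
      unfolding T_def using tilde_continuous[OF fB] by (intro closed_Collect_le continuous_intros)
    have nT: "g n k \<notin> T" using \<epsilon> f by (simp add: T_def M_ideal_def)
    have "(\<lambda>k. G1 (g n k)) \<in> J_ideal A k" using b(1) by (simp add: G1b)
    from localise[OF G1 this cT nT] obtain d where d: "\<And>x. 0 \<le> d x \<and> d x \<le> 1"
      "\<And>x. x \<in> T \<Longrightarrow> d x = 1" "(\<lambda>x. complex_of_real (d x) * G1 x) \<in> J_ideal B (g n k)"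
      by blast
    have "cmod ((complex_of_real (d x) * G1 x) * f x - f x) \<le> 2 * \<epsilon> / 3" for x
    proof -
      have "cmod (complex_of_real (1 - d x) * f x) \<le> \<epsilon>/3"
      proof (cases "x \<in> T")
        case True
        then show ?thesis using d(2) \<epsilon> by simp
      next
        case False
        have "\<bar>1 - d x\<bar> * cmod (f x) \<le> 1 * (\<epsilon>/3)"
          using False d(1)[of x] by (intro mult_mono) (auto simp: T_def)
        then show ?thesis by (simp only: norm_mult norm_of_real)
      qed
      moreover have "cmod (complex_of_real (d x) * (G1 x * f x - f x)) \<le> \<epsilon>/3"
      proof -
        have "\<bar>d x\<bar> * cmod (G1 x * f x - f x) \<le> 1 * (\<epsilon>/3)"
          using d(1)[of x] G1f[of x] by (intro mult_mono) auto
        then show ?thesis by (simp only: norm_mult norm_of_real)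
      qed
      moreover have "(complex_of_real (d x) * G1 x) * f x - f x =
          complex_of_real (d x) * (G1 x * f x - f x) - complex_of_real (1 - d x) * f x"
        by (simp add: algebra_simps)
      ultimately show ?thesis
        using norm_triangle_ineq4[of "complex_of_real (d x) * (G1 x * f x - f x)"
            "complex_of_real (1 - d x) * f x"] by simp
    qed
    then have "sup_norm (\<lambda>x. (complex_of_real (d x) * G1 x) * f x - f x) < \<epsilon>"
      by (rule sup_norm_less) (use \<epsilon> in simp)
    then show "\<exists>u\<in>J_ideal B (g n k). sup_norm (\<lambda>x. u x * f x - f x) < \<epsilon>"
      by (intro bexI[OF _ d(3)])
  qed
qed

section \<open>From single points to the whole space\<close>

lemma all_points_iff:
  assumes piece: "\<And>n k. P (g n k) \<longleftrightarrow> Q k" and outside: "\<And>x. (\<And>n. x \<notin> K n) \<Longrightarrow> P x"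
  shows "(\<forall>x. P x) \<longleftrightarrow> (\<forall>k. Q k)"
proof
  assume "\<forall>x. P x" then show "\<forall>k. Q k" using piece[of 0] by blast
next
  assume Q: "\<forall>k. Q k"
  show "\<forall>x. P x"
  proof
    fix x show "P x"
      using outside[of x] piece Q g_h by metis
  qed
qed

lemma ditkin_at_outside: "(\<And>n. x \<notin> K n) \<Longrightarrow> ditkin_at B x"
  by (rule B.ditkin_at_if_bounded_rel_units[OF bounded_rel_units_at_outside])

lemma strongly_regular_at_outside: "(\<And>n. x \<notin> K n) \<Longrightarrow> strongly_regular_at B x"
  by (rule B.strongly_regular_at_if_ditkin[OF ditkin_at_outside])

lemma peak_points_tilde_iff: "(\<forall>x. peak_point B x) \<longleftrightarrow> (\<forall>k. peak_point A k)"
  by (rule all_points_iff[where P = "peak_point B" and Q = "peak_point A", OF peak_point_piece_iff peak_point_outside])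

lemma bounded_rel_units_tilde_iff: "bounded_rel_units B \<longleftrightarrow> bounded_rel_units A"
  unfolding bounded_rel_units_def
proof (rule all_points_iff)
  show "bounded_rel_units_at B (g n k) = bounded_rel_units_at A k" for n k
    using bounded_rel_units_at_piece_iff by (auto simp: bounded_rel_units_at_def)
  show "bounded_rel_units_at B x" if "\<And>n. x \<notin> K n" for x
    unfolding bounded_rel_units_at_def using bounded_rel_units_at_outside[OF that] by blast
qed

lemma strongly_regular_tilde_iff: "strongly_regular B \<longleftrightarrow> strongly_regular A"
  unfolding strongly_regular_def
  by (rule all_points_iff[where P = "strongly_regular_at B" and Q = "strongly_regular_at A", OF strongly_regular_at_piece_iff strongly_regular_at_outside])

lemma ditkin_tilde_iff: "ditkin_algebra B \<longleftrightarrow> ditkin_algebra A"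
  unfolding ditkin_algebra_def
  by (rule all_points_iff[where P = "ditkin_at B" and Q = "ditkin_at A", OF ditkin_at_piece_iff ditkin_at_outside])

end

section \<open>Existence of a dense null family\<close>

text \<open>For each \<open>j\<close>, compactness covers the space by finitely many balls of radius
  \<open>1/(j+1)\<close>. It is enough that some listed set fits inside every nonempty open set,
  since this is what places a piece there.\<close>

lemma countable_nonempty_open_base:
  assumes "compact (UNIV :: 'x::metric_space set)"
  obtains V :: "nat \<Rightarrow> 'x::metric_space set" where "\<And>n. open (V n)" "\<And>n. V n \<noteq> {}"
    "\<And>U. open U \<Longrightarrow> U \<noteq> {} \<Longrightarrow> \<exists>n. V n \<subseteq> U"
proof -
  have "\<forall>j. \<exists>S::'x set. finite S \<and> UNIV \<subseteq> (\<Union>x\<in>S. ball x (1 / real (Suc j)))"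
  proof
    fix j
    show "\<exists>S::'x set. finite S \<and> UNIV \<subseteq> (\<Union>x\<in>S. ball x (1 / real (Suc j)))"
      using compactE_image[OF assms, of UNIV "\<lambda>x. ball x (1 / real (Suc j))"]
      by (metis UNIV_I UN_I centre_in_ball divide_pos_pos of_nat_0_less_iff open_ball subsetI zero_less_Suc zero_less_one)
  qed
  from choice[OF this] obtain S :: "nat \<Rightarrow> 'x set" where
    S: "\<And>j. finite (S j)" "\<And>j. UNIV \<subseteq> (\<Union>x\<in>S j. ball x (1 / real (Suc j)))"
    by blast
  define W where "W = (\<Union>j. (\<lambda>x. ball x (1 / real (Suc j))) ` S j)"
  have cW: "countable W"
    unfolding W_def by (rule countable_UN) (simp_all add: S(1) countable_finite)
  have "S 0 \<noteq> {}" using S(2)[of 0] by auto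
  then have neW: "W \<noteq> {}" by (auto simp: W_def)
  have W: "open w" "w \<noteq> {}" if "w \<in> W" for w
    using that by (auto simp: W_def)
  have base: "\<exists>w\<in>W. w \<subseteq> U" if "open U" "U \<noteq> {}" for U
  proof -
    obtain p e where p: "e > 0" "ball p e \<subseteq> U"
      using \<open>open U\<close> \<open>U \<noteq> {}\<close> open_contains_ball by blast
    \<comment> \<open>A ball of radius below \<open>e/2\<close> that contains \<open>p\<close> lies
      in \<open>ball p e\<close>.\<close>
    obtain j where j: "1 / real (Suc j) < e / 2"
      using nat_approx_posE[of "e/2"] p(1) by auto
    obtain x where x: "x \<in> S j" "p \<in> ball x (1 / real (Suc j))"
      using S(2)[of j] by blast
    have "ball x (1 / real (Suc j)) \<subseteq> ball p e"
    proof
      fix y assume "y \<in> ball x (1 / real (Suc j))"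
      then show "y \<in> ball p e"
        using x(2) j dist_triangle[of p y x] by (simp add: dist_commute)
    qed
    then show ?thesis
      using x(1) p(2) by (intro bexI[of _ "ball x (1 / real (Suc j))"]) (auto simp: W_def)
  qed
  show thesis
  proof
    show "open (from_nat_into W n)" "from_nat_into W n \<noteq> {}" for n
      using W from_nat_into[OF neW] by auto
    show "\<exists>n. from_nat_into W n \<subseteq> U" if "open U" "U \<noteq> {}" for U
      using base[OF that] from_nat_into_surj[OF cW] by metis
  qed
qed

text \<open>A nonempty open set survives the removal of each closed set with empty interior; this
  leaves room for the next piece away from the earlier ones.\<close>

lemma nowhere_dense_finite_Union_complement:
  fixes f :: "nat \<Rightarrow> 'x::topological_space set"
  assumes "\<And>i. i < n \<Longrightarrow> closed (f i) \<and> nowhere_dense (f i)" "open V" "V \<noteq> {}"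
  shows "V - (\<Union>i<n. f i) \<noteq> {} \<and> open (V - (\<Union>i<n. f i))"
  using assms
proof (induction n)
  case 0
  then show ?case by simp
next
  case (Suc n)
  let ?W = "V - (\<Union>i<n. f i)"
  have W: "?W \<noteq> {}" "open ?W" using Suc by auto
  have fn: "closed (f n)" "interior (f n) = {}"
    using Suc.prems(1)[of n] by (auto simp: nowhere_dense_def)
  have eq: "V - (\<Union>i<Suc n. f i) = ?W - f n" by (auto simp: lessThan_Suc)
  have "\<not> ?W \<subseteq> f n"
    using W fn(2) interior_maximal[of ?W "f n"] by auto
  then show ?case unfolding eq using W(2) fn(1) by auto
qed

text \<open>Putting the \<open>n\<close>-th piece inside \<open>V n\<close> yields a whole piece in
  every nonempty open set, which is more than density of the union and is what essentialness
  uses.\<close>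

lemma dense_null_family_exists:
  assumes cpt: "compact (UNIV :: 'x::metric_space set)" and cptk: "compact (UNIV :: 'k::t2_space set)"
    and copies: "\<And>U :: 'x::metric_space set. open U \<Longrightarrow> U \<noteq> {} \<Longrightarrow>
      \<exists>S \<subseteq> U. nowhere_dense S \<and> S homeomorphic (UNIV :: 'k::t2_space set)"
  obtains K :: "nat \<Rightarrow> 'x::metric_space set" where "null_family K" "\<And>n. nowhere_dense (K n)"
    "\<And>n. K n homeomorphic (UNIV :: 'k::t2_space set)" "\<And>U. open U \<Longrightarrow> U \<noteq> {} \<Longrightarrow> \<exists>n. K n \<subseteq> U"
proof -
  obtain V :: "nat \<Rightarrow> 'x set" where V: "\<And>n. open (V n)" "\<And>n. V n \<noteq> {}"
    "\<And>U. open U \<Longrightarrow> U \<noteq> {} \<Longrightarrow> \<exists>n. V n \<subseteq> U"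
    using countable_nonempty_open_base[OF cpt] by metis
  define P where "P = (\<lambda>(f :: nat \<Rightarrow> 'x set) n S. nowhere_dense S \<and> S homeomorphic (UNIV :: 'k set) \<and>
    S \<subseteq> V n \<and> S \<inter> (\<Union>i<n. f i) = {} \<and> diameter S \<le> 2 / real (Suc n))"
  have closed_copy: "closed S" if "S homeomorphic (UNIV :: 'k set)" for S :: "'x set"
    using homeomorphic_compactness[OF that] cptk compact_imp_closed by blast
  \<comment> \<open>Recursion on the earlier pieces: \<open>P f n\<close> depends only on the values
    of \<open>f\<close> below \<open>n\<close>, as dependent choice requires.\<close>
  have "\<exists>f. \<forall>n. P f n (f n)"
  proof (rule dependent_wellorder_choice)
    show "P f n S = P f' n S" if "\<And>m. m < n \<Longrightarrow> f m = f' m" for S f f' n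
    proof -
      have "(\<Union>i<n. f i) = (\<Union>i<n. f' i)" using that by auto
      then show ?thesis unfolding P_def by metis
    qed
    fix n f assume prev: "\<And>m. m < n \<Longrightarrow> P f m (f m)"
    then have "closed (f i) \<and> nowhere_dense (f i)" if "i < n" for i
      using that closed_copy by (auto simp: P_def)
    from nowhere_dense_finite_Union_complement[OF this V(1)[of n] V(2)[of n]]
    have W: "V n - (\<Union>i<n. f i) \<noteq> {}" "open (V n - (\<Union>i<n. f i))" by auto
    then obtain p where p: "p \<in> V n - (\<Union>i<n. f i)" by blast
    \<comment> \<open>This radius bounds the diameter by \<open>2/(n+1)\<close>, which tends to 0;
      \<open>Suc\<close> makes the case \<open>n = 0\<close> a genuine ball.\<close>
    let ?r = "1 / real (Suc n)"
    let ?U = "(V n - (\<Union>i<n. f i)) \<inter> ball p ?r"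
    have "open ?U" "?U \<noteq> {}" using W(2) p by auto
    then obtain S where S: "S \<subseteq> ?U" "nowhere_dense S" "S homeomorphic (UNIV :: 'k set)"
      using copies by meson
    have "dist x y \<le> 2 * ?r" if "x \<in> S" "y \<in> S" for x y
    proof -
      have "dist p x < ?r" "dist p y < ?r" using that S(1) by auto
      then show ?thesis using dist_triangle3[of x y p] by linarith
    qed
    then have "diameter S \<le> 2 * ?r"
      unfolding diameter_def by (auto intro!: cSUP_least)
    then show "\<exists>S. P f n S"
      using S by (intro exI[of _ S]) (auto simp: P_def)
  qed
  then obtain K where "\<And>n. P K n (K n)" by blast
  then have K: "\<And>n. nowhere_dense (K n)" "\<And>n. K n homeomorphic (UNIV :: 'k set)"
      "\<And>n. K n \<subseteq> V n" "\<And>n. K n \<inter> (\<Union>i<n. K i) = {}" "\<And>n. diameter (K n) \<le> 2 / real (Suc n)"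
    by (auto simp: P_def)
  have cK: "compact (K n)" for n
    using homeomorphic_compactness[OF K(2)] cptk by blast
  have disj: "K m \<inter> K n = {}" if "m < n" for m n
    using K(4)[of n] that by auto
  have "null_family K"
  proof
    show "disjoint_family K"
      unfolding disjoint_family_on_def using disj by (metis Int_commute linorder_neqE_nat)
    show "(\<lambda>n. diameter (K n)) \<longlonglongrightarrow> 0"
    proof (rule tendsto_sandwich[OF always_eventually always_eventually tendsto_const])
      show "(\<lambda>n. 2 / real (Suc n)) \<longlonglongrightarrow> 0"
        using LIMSEQ_Suc[OF lim_const_over_n[of 2]] by simp
    qed (use K(5) cK diameter_ge_0 compact_imp_bounded in auto)
  qed (use cpt cK in auto)
  moreover have "\<exists>n. K n \<subseteq> U" if "open U" "U \<noteq> {}" for U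
    using V(3)[OF that] K(3) by (meson subset_trans)
  ultimately show thesis using that K(1,2) by blast
qed

theorem theorem1p1:
  fixes A :: "('k::t2_space \<Rightarrow> complex) set"
  assumes "compact (UNIV :: 'k set)"
    and "uniform_algebra A"
    and "nontrivial_algebra A"
    and "compact (UNIV :: 'x::metric_space set)"
    and "\<forall>U :: 'x set. open U \<and> U \<noteq> {} \<longrightarrow>
           (\<exists>S \<subseteq> U. nowhere_dense S \<and> S homeomorphic (UNIV :: 'k set))"
  shows "\<exists>Kn :: nat \<Rightarrow> 'x set.
    disjoint_family Kn \<and>
    (\<forall>n. nowhere_dense (Kn n)) \<and>
    (\<forall>n. Kn n homeomorphic (UNIV :: 'k set)) \<and>
    closure (\<Union>n. Kn n) = UNIV \<and>
    (\<lambda>n. diameter (Kn n)) \<longlonglongrightarrow> 0 \<and>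
    (\<forall>h :: nat \<Rightarrow> 'x \<Rightarrow> 'k.
       (\<forall>n. \<exists>g. homeomorphism (Kn n) UNIV (h n) g) \<longrightarrow>
       (let At = tilde_algebra A Kn h in
          uniform_algebra At \<and>
          essential_algebra At \<and>
          (\<forall>n. restrict_algebra At (Kn n) = transport_algebra A (Kn n) (h n)) \<and>
          (natural_algebra At \<longleftrightarrow> natural_algebra A) \<and>
          (regular_on_space At \<longleftrightarrow> regular_on_space A) \<and>
          (normal_algebra At \<longleftrightarrow> normal_algebra A) \<and>
          ((\<forall>x. peak_point At x) \<longleftrightarrow> (\<forall>x. peak_point A x)) \<and>
          (bounded_rel_units At \<longleftrightarrow> bounded_rel_units A) \<and>
          (strongly_regular At \<longleftrightarrow> strongly_regular A) \<and>
          (ditkin_algebra At \<longleftrightarrow> ditkin_algebra A) \<and>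
          (\<forall>x. x \<notin> (\<Union>n. Kn n) \<longrightarrow>
             bounded_rel_units_at_with At x 1 \<and>
             peak_point At x \<and>
             ditkin_at At x \<and>
             strongly_regular_at At x)))"
proof -
  have copies: "\<exists>S \<subseteq> U. nowhere_dense S \<and> S homeomorphic (UNIV :: 'k set)"
    if "open U" "U \<noteq> {}" for U :: "'x set"
    using assms(5) that by blast
  obtain K :: "nat \<Rightarrow> 'x set" where K: "null_family K" "\<And>n. nowhere_dense (K n)"
    "\<And>n. K n homeomorphic (UNIV :: 'k set)" "\<And>U. open U \<Longrightarrow> U \<noteq> {} \<Longrightarrow> \<exists>n. K n \<subseteq> U"
    using dense_null_family_exists[OF assms(4,1) copies] by blast
  interpret K: null_family K by (rule K(1))
  have nonempty: "K n \<noteq> {}" for n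
    using K(3)[of n] by (auto simp: homeomorphic_empty)
  have dense: "closure (\<Union>n. K n) = UNIV"
  proof (rule ccontr)
    assume "closure (\<Union>n. K n) \<noteq> UNIV"
    then obtain n where "K n \<subseteq> - closure (\<Union>n. K n)"
      using K(4)[of "- closure (\<Union>n. K n)"] by (auto simp: open_Compl)
    moreover have "K n \<subseteq> closure (\<Union>n. K n)"
      by (rule order_trans[OF UN_upper closure_subset]) simp
    ultimately have "K n \<subseteq> {}" by (metis Compl_disjoint2 le_inf_iff)
    then show False using nonempty[of n] by simp
  qed
  show ?thesis
  proof (intro exI[of _ K] conjI allI impI K.disjoint_pieces K.diameter_pieces K(2,3) dense, goal_cases)
    case (1 h)
    from choice[OF 1] obtain g where g: "\<And>n. homeomorphism (K n) UNIV (h n) (g n)" by blast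
    interpret inserted_algebra K A h g
      by unfold_locales (use assms(1,2) g in auto)
    show ?case
      unfolding Let_def
      using tilde_algebra essential_tilde[OF K(4) assms(3)] restrict_tilde natural_tilde_iff
        regular_tilde_iff normal_tilde_iff peak_points_tilde_iff bounded_rel_units_tilde_iff
        strongly_regular_tilde_iff ditkin_tilde_iff bounded_rel_units_at_outside
        peak_point_outside ditkin_at_outside strongly_regular_at_outside
      by simp
  qed
qed

end
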